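(* Let $a,\kappa,\rho,\nu$ satisfy the assumptions (A1)--(A4) listed in the context. Let $s\in\mathbb{S}^2$ and let $A\in\mathbb{R}^{3\times3}$ have all its columns in $T_s\mathbb{S}^2$. Then the unique minimizer of the problem $$f_{\rm hom}(s,A)=\inf_{v\in L^2_{\#,0}(Q;T_s\mathbb{S}^2)}\int_{\mathbb{R}^3}\int_Q \left[a(z,z+\xi)\rho(\xi)\frac{|A\xi+v(z+\xi)-v(z)|^2}{|\xi|^2}+\kappa(z,z+\xi)\frac{A\xi+v(z+\xi)-v(z)}{|\xi|}\cdot(s\times\nu(\xi))\right]dz\,d\xi$$ is given by $$v_{s,A}:=Av_a+s\times v_\kappa,$$ where $v_a$ and $v_\kappa$ are the unique solutions (minimizers) of, respectively, $$\inf_{v\in L^2_{\#,0}(Q;\mathbb{R}^3)}\int_{\mathbb{R}^3}\int_Q a(z,z+\xi)\rho(\xi)\frac{|\xi+v(z+\xi)-v(z)|^2}{|\xi|^2}\,dz\,d\xi,$$ $$\inf_{v\in L^2_{\#,0}(Q;\mathbb{R}^3)}\int_{\mathbb{R}^3}\int_Q \left[a(z,z+\xi)\rho(\xi)\frac{|v(z+\xi)-v(z)|^2}{|\xi|^2}+\kappa(z,z+\xi)\nu(\xi)\cdot\frac{v(z+\xi)-v(z)}{|\xi|}\right]dz\,d\xi.$$ Moreover, $$f_{\rm hom}(s,A)=(A\overline{T}):A+\sum_{i=1}^3 s\cdot(\bar d_i\times Ae_i)-\int_{\mathbb{R}^3}\int_Q a(z,z+\xi)\rho(\xi)\frac{|v_{s,A}(z+\xi)-v_{s,A}(z)|^2}{|\xi|^2}\,dz\,d\xi,$$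 with the matrix $\overline{T}\in\mathbb{R}^{3\times3}$ and the vectors $\bar d_i\in\mathbb{R}^3$ given by $$\overline{T}:=\int_{\mathbb{R}^3}\int_Q a(z,z+\xi)\rho(\xi)\left(\frac{\xi}{|\xi|}\otimes\frac{\xi}{|\xi|}\right)dz\,d\xi,\qquad \bar d_i:=\int_{\mathbb{R}^3}\int_Q\kappa(z,z+\xi)\nu(\xi)\frac{\xi_i}{|\xi|}\,dz\,d\xi\quad(i\in\{1,2,3\}).$$
   Context: $Q=(0,1)^3$; $\mathbb{S}^2\subset\mathbb{R}^3$ is the unit sphere and $T_s\mathbb{S}^2=\{v\in\mathbb{R}^3:v\cdot s=0\}$. For a linear subspace $V\subset\mathbb{R}^3$, $L^2_{\#,0}(Q;V)$ is the space of $Q$-periodic functions $v:\mathbb{R}^3\to V$ that are in $L^2(Q)$ and satisfy $\int_Q v\,dz=0$. $:$ is the Frobenius inner product of matrices and $e_i$ the canonical basis vectors of $\mathbb{R}^3$. Assumptions: (A1) $a,\kappa\in L^\infty(\mathbb{R}^3\times\mathbb{R}^3)$ are real-valued and $Q$-periodic in both arguments, and $a(x,y)\ge a_0>0$ for a.e. $x,y\in\mathbb{R}^3$. (A2) $\rho\in L^1(\mathbb{R}^3)$ is non-negative, $\|\rho\|_{L^1(\mathbb{R}^3)}=1$, and $\operatorname{ess\,inf}_{\xi\in B_r(0)}\rho(\xi)/|\xi|^2>0$ for some $r>0$. (A3) $\nu\in L^1(\mathbb{R}^3;\mathbb{R}^3)$ with $\|\nu\|_{L^1(\mathbb{R}^3;\mathbb{R}^3)}=1$.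 (A4) $\|\nu/\rho^{1/2}\|_{L^2(\mathbb{R}^3)}<+\infty$ (in particular $\nu=0$ a.e. where $\rho=0$, the quotient being read as $0$ there). *)

theory Defs
  imports "HOL-Probability.Essential_Supremum"
begin

text \<open>
  Elements of Lebesgue spaces are represented by Borel functions (every class of Lebesgue
  measurable functions has a Borel representative). Accordingly, pointwise requirements on them
  (periodicity, sign, values in a subspace) are imposed almost everywhere, and uniqueness
  of a minimizer is uniqueness up to a null set.
\<close>

definition unit_cube :: "(real^3) set" where
  "unit_cube = {z. \<forall>i. 0 < z $ i \<and> z $ i < 1}"

definition tangent_space :: "real^3 \<Rightarrow> (real^3) set" where
  "tangent_space s = {v. v \<bullet> s = 0}"

definition tensor :: "real^3 \<Rightarrow> real^3 \<Rightarrow> real^3^3" where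
  "tensor u w = (\<chi> i j. u $ i * w $ j)"

definition ae_period :: "'a::euclidean_space \<Rightarrow> ('a \<Rightarrow> 'b) \<Rightarrow> bool" where
  "ae_period p f \<longleftrightarrow> (AE x in lborel. f (x + p) = f x)"

definition Q_periodic :: "(real^3 \<Rightarrow> 'b) \<Rightarrow> bool" where
  "Q_periodic f \<longleftrightarrow> (\<forall>i. ae_period (axis i 1) f)"

definition Q_periodic2 :: "((real^3) \<times> (real^3) \<Rightarrow> 'b) \<Rightarrow> bool" where
  "Q_periodic2 f \<longleftrightarrow> (\<forall>i. ae_period (axis i 1, 0) f \<and> ae_period (0, axis i 1) f)"

definition in_Linfty :: "('a::euclidean_space \<Rightarrow> real) \<Rightarrow> bool" where
  "in_Linfty f \<longleftrightarrow> f \<in> borel_measurable lborel \<and> (\<exists>C. AE x in lborel. \<bar>f x\<bar> \<le> C)"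

definition essinf :: "'a measure \<Rightarrow> ('a \<Rightarrow> ereal) \<Rightarrow> ereal" where
  "essinf M f = - esssup M (\<lambda>x. - f x)"

definition L2_per0 :: "(real^3) set \<Rightarrow> (real^3 \<Rightarrow> real^3) set" where
  "L2_per0 V = {v. v \<in> borel_measurable lborel \<and> (AE z in lborel. v z \<in> V) \<and> Q_periodic v \<and>
     set_integrable lborel unit_cube (\<lambda>z. (norm (v z))\<^sup>2) \<and>
     (LINT z:unit_cube|lborel. v z) = 0}"

text \<open>
  The energies below need not be finite on all of \<open>L2_per0 V\<close>, so the Bochner integral
  (which is 0 on non-integrable functions) would be wrong for them. We use the extended
  integral, positive part minus negative part (\<^const>\<open>ennreal\<close> truncates negative
  reals to 0). In the energies the negative part has a finite integral, because \<open>\<nu> / sqrt \<rho>\<close>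
  is square integrable, so that the undetermined case \<open>\<infinity> - \<infinity>\<close> does not occur.
  The variable of the outer integral over the whole space is the second argument of \<open>f\<close>.
\<close>

definition cell_integral :: "(real^3 \<Rightarrow> real^3 \<Rightarrow> real) \<Rightarrow> ereal" where
  "cell_integral f =
     enn2ereal (\<integral>\<^sup>+ \<xi>. (\<integral>\<^sup>+ z\<in>unit_cube. ennreal (f z \<xi>) \<partial>lborel) \<partial>lborel) -
     enn2ereal (\<integral>\<^sup>+ \<xi>. (\<integral>\<^sup>+ z\<in>unit_cube. ennreal (- f z \<xi>) \<partial>lborel) \<partial>lborel)"

definition ae_unique_minimizer ::
    "((real^3 \<Rightarrow> real^3) \<Rightarrow> ereal) \<Rightarrow> (real^3 \<Rightarrow> real^3) set \<Rightarrow> (real^3 \<Rightarrow> real^3) \<Rightarrow> bool" where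
  "ae_unique_minimizer F K v \<longleftrightarrow> is_arg_min F (\<lambda>u. u \<in> K) v \<and>
     (\<forall>w. is_arg_min F (\<lambda>u. u \<in> K) w \<longrightarrow> (AE z in lborel. w z = v z))"

definition hom_energy ::
    "((real^3) \<times> (real^3) \<Rightarrow> real) \<Rightarrow> ((real^3) \<times> (real^3) \<Rightarrow> real) \<Rightarrow> (real^3 \<Rightarrow> real) \<Rightarrow>
     (real^3 \<Rightarrow> real^3) \<Rightarrow> real^3 \<Rightarrow> real^3^3 \<Rightarrow> (real^3 \<Rightarrow> real^3) \<Rightarrow> ereal" where
  "hom_energy a \<kappa> \<rho> \<nu> s A v = cell_integral (\<lambda>z \<xi>.
     a (z, z + \<xi>) * \<rho> \<xi> * ((norm (A *v \<xi> + v (z + \<xi>) - v z))\<^sup>2 / (norm \<xi>)\<^sup>2) +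
     \<kappa> (z, z + \<xi>) * (((A *v \<xi> + v (z + \<xi>) - v z) /\<^sub>R norm \<xi>) \<bullet> cross3 s (\<nu> \<xi>)))"

definition f_hom ::
    "((real^3) \<times> (real^3) \<Rightarrow> real) \<Rightarrow> ((real^3) \<times> (real^3) \<Rightarrow> real) \<Rightarrow> (real^3 \<Rightarrow> real) \<Rightarrow>
     (real^3 \<Rightarrow> real^3) \<Rightarrow> real^3 \<Rightarrow> real^3^3 \<Rightarrow> ereal" where
  "f_hom a \<kappa> \<rho> \<nu> s A = (INF v\<in>L2_per0 (tangent_space s). hom_energy a \<kappa> \<rho> \<nu> s A v)"

definition exchange_cell_energy ::
    "((real^3) \<times> (real^3) \<Rightarrow> real) \<Rightarrow> (real^3 \<Rightarrow> real) \<Rightarrow> (real^3 \<Rightarrow> real^3) \<Rightarrow> ereal" where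
  "exchange_cell_energy a \<rho> v = cell_integral (\<lambda>z \<xi>.
     a (z, z + \<xi>) * \<rho> \<xi> * ((norm (\<xi> + v (z + \<xi>) - v z))\<^sup>2 / (norm \<xi>)\<^sup>2))"

definition dmi_cell_energy ::
    "((real^3) \<times> (real^3) \<Rightarrow> real) \<Rightarrow> ((real^3) \<times> (real^3) \<Rightarrow> real) \<Rightarrow> (real^3 \<Rightarrow> real) \<Rightarrow>
     (real^3 \<Rightarrow> real^3) \<Rightarrow> (real^3 \<Rightarrow> real^3) \<Rightarrow> ereal" where
  "dmi_cell_energy a \<kappa> \<rho> \<nu> v = cell_integral (\<lambda>z \<xi>.
     a (z, z + \<xi>) * \<rho> \<xi> * ((norm (v (z + \<xi>) - v z))\<^sup>2 / (norm \<xi>)\<^sup>2) +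
     \<kappa> (z, z + \<xi>) * (\<nu> \<xi> \<bullet> ((v (z + \<xi>) - v z) /\<^sub>R norm \<xi>)))"

definition dirichlet_energy ::
    "((real^3) \<times> (real^3) \<Rightarrow> real) \<Rightarrow> (real^3 \<Rightarrow> real) \<Rightarrow> (real^3 \<Rightarrow> real^3) \<Rightarrow> ereal" where
  "dirichlet_energy a \<rho> v = cell_integral (\<lambda>z \<xi>.
     a (z, z + \<xi>) * \<rho> \<xi> * ((norm (v (z + \<xi>) - v z))\<^sup>2 / (norm \<xi>)\<^sup>2))"

definition T_bar :: "((real^3) \<times> (real^3) \<Rightarrow> real) \<Rightarrow> (real^3 \<Rightarrow> real) \<Rightarrow> real^3^3" where
  "T_bar a \<rho> = (LINT \<xi>|lborel. (LINT z:unit_cube|lborel.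
     (a (z, z + \<xi>) * \<rho> \<xi>) *\<^sub>R tensor (\<xi> /\<^sub>R norm \<xi>) (\<xi> /\<^sub>R norm \<xi>)))"

definition d_bar :: "((real^3) \<times> (real^3) \<Rightarrow> real) \<Rightarrow> (real^3 \<Rightarrow> real^3) \<Rightarrow> 3 \<Rightarrow> real^3" where
  "d_bar \<kappa> \<nu> i = (LINT \<xi>|lborel. (LINT z:unit_cube|lborel.
     (\<kappa> (z, z + \<xi>) * (\<xi> $ i / norm \<xi>)) *\<^sub>R \<nu> \<xi>))"

text \<open>
  The inner product \<open>\<bullet>\<close> on \<^typ>\<open>real^3^3\<close> is the Frobenius inner product.
\<close>

end

theory Submission
  imports Defs "HOL-Probability.Probability_Measure"
begin

text \<open>
  Put \<open>weight (z, \<xi>) = a (z, z + \<xi>) * \<rho> \<xi>\<close>, \<open>kernel (z, \<xi>) = \<kappa> (z, z + \<xi>)\<close> and write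
  \<open>diff_quot v (z, \<xi>)\<close> for \<open>(v (z + \<xi>) - v z) / |\<xi>|\<close>. Each of the three minimum problems involves
  an integrand \<open>weight * |x|\<^sup>2 + kernel * (x \<bullet> S \<nu>)\<close> with \<open>x = B (\<xi> / |\<xi>|) + diff_quot v\<close> for linear
  maps \<open>B\<close> and \<open>S\<close>. Completing the square, with \<open>\<nu> / sqrt \<rho>\<close> square integrable, gives up to a finite
  constant (\<open>functional_eq_energy\<close>) the energy \<open>|g + diff_quot v|\<^sup>2\<close> integrated against \<open>weight\<close>,
  where \<open>g = B (\<xi> / |\<xi>|) + S (kernel * \<nu> / (2 * weight))\<close>. So all three are problems of projecting a
  field \<open>g\<close> onto the space of difference quotients in a weighted \<open>L\<^sup>2\<close> space.

  Such a problem is solved by its Euler-Lagrange equation: a function is a minimizer if and only if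
  it is \<open>critical\<close>, that is, \<open>g + diff_quot v\<close> is orthogonal to all difference quotients of finite
  Dirichlet energy (\<open>minimizer_critical\<close>, \<open>critical_minimizer\<close>). Existence (\<open>minimizer_exists\<close>)
  and uniqueness (\<open>critical_unique\<close>) rest on the inequality \<open>poincare\<close>. It holds since \<open>weight\<close>
  is at least a multiple of \<open>|\<xi>|\<^sup>2\<close> for short increments \<open>\<xi>\<close>: the Dirichlet energy controls short
  increments of \<open>v\<close>, by periodicity and repeated doubling it controls those of unit length, and
  these control the distance of \<open>v\<close> from its mean.

  The Euler-Lagrange equation is linear in \<open>g\<close>, and a linear map acting on values can be moved onto
  the test function. The sources of the exchange problem and of the problem for \<open>\<nu>\<close> are
  \<open>\<xi> / |\<xi>|\<close> and \<open>kernel * \<nu> / (2 * weight)\<close>; that of the homogenized problem is the image of the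
  first under \<open>A\<close> plus the image of the second under the cross product with \<open>s\<close>. Both maps have
  values in the tangent space, so the same combination of the two minimizers is critical for the
  homogenized problem (\<open>critical_superposition\<close>). By Pythagoras the minimum is the value of the
  functional at 0 minus the Dirichlet energy of the minimizer (\<open>critical_functional_value\<close>), and
  Fubini's theorem expresses the value at 0 through \<open>T_bar\<close> and \<open>d_bar\<close>.
\<close>

section \<open>Translations, shears and null sets\<close>

lemma AE_lborel_translate:
  fixes c :: "'a::euclidean_space"
  assumes "AE x in lborel. P x"
  shows "AE x in lborel. P (x + c)"
proof -
  have "AE x in distr lborel borel ((+) c). P x"
    using assms unfolding lborel_distr_plus .
  then show ?thesis
    using AE_distrD[of "(+) c" lborel borel P] by (simp add: add.commute)
qed

lemma nn_integral_lborel_translate: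
  fixes f :: "'a::euclidean_space \<Rightarrow> ennreal"
  assumes [measurable]: "f \<in> borel_measurable borel"
  shows "(\<integral>\<^sup>+ x. f (x + c) \<partial>lborel) = (\<integral>\<^sup>+ x. f x \<partial>lborel)"
proof -
  have "(\<integral>\<^sup>+ x. f x \<partial>lborel) = (\<integral>\<^sup>+ x. f x \<partial>distr lborel borel ((+) c))"
    by (simp add: lborel_distr_plus)
  also have "\<dots> = (\<integral>\<^sup>+ x. f (x + c) \<partial>lborel)"
    by (subst nn_integral_distr) (simp_all add: add.commute)
  finally show ?thesis by simp
qed

lemma nn_integral_lborel_scale:
  fixes f :: "'a::euclidean_space \<Rightarrow> ennreal"
  assumes [measurable]: "f \<in> borel_measurable borel" and "c \<noteq> 0"
  shows "(\<integral>\<^sup>+ x. f x \<partial>lborel) = ennreal (\<bar>c\<bar> ^ DIM('a)) * (\<integral>\<^sup>+ x. f (c *\<^sub>R x) \<partial>lborel)"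
  by (subst lborel_affine[OF \<open>c \<noteq> 0\<close>, of 0])
     (simp add: nn_integral_density nn_integral_distr nn_integral_cmult)

text \<open>
  Fubini reduces the shear \<open>(x, y) \<mapsto> (x, x + y)\<close> to a translation on each vertical fibre, and
  translations preserve null sets. This is what turns an almost everywhere bound on \<open>a\<close> into one on
  \<open>(z, \<xi>) \<mapsto> a (z, z + \<xi>)\<close>.
\<close>

lemma AE_lborel_shear:
  fixes P :: "'a::euclidean_space \<times> 'a \<Rightarrow> bool"
  assumes "AE p in lborel. P p"
  shows "AE p in lborel. P (fst p, fst p + snd p)"
proof -
  obtain N where N: "{p. \<not> P p} \<subseteq> N" "N \<in> sets lborel" "emeasure lborel N = 0"
    using assms by (auto elim!: AE_E)
  have N'[measurable]: "N \<in> sets (borel \<Otimes>\<^sub>M borel)"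
    using N(2) unfolding sets_lborel borel_prod[symmetric] .
  have "AE p in lborel. p \<notin> N"
    using N by (intro AE_not_in) auto
  then have "AE p in (lborel \<Otimes>\<^sub>M lborel :: ('a \<times> 'a) measure). p \<notin> N"
    unfolding lborel_prod .
  then have "AE x in (lborel::'a measure). AE y in lborel. (x, y) \<notin> N"
    by (rule lborel_pair.AE_pair)
  then have "AE x in (lborel::'a measure). AE y in lborel. (x, x + y) \<notin> N"
    proof eventually_elim
    case (elim x)
    from AE_lborel_translate[OF elim, of x] show ?case
      by (simp add: add.commute)
  qed
  then have "AE p in (lborel \<Otimes>\<^sub>M lborel :: ('a \<times> 'a) measure). (fst p, fst p + snd p) \<notin> N"
    by (intro lborel_pair.AE_pair_measure[rotated]) (simp, measurable)
  then have "AE p in (lborel :: ('a \<times> 'a) measure). (fst p, fst p + snd p) \<notin> N"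
    unfolding lborel_prod .
  then show ?thesis
    using N(1) by (auto elim!: eventually_mono)
qed

lemma (in pair_sigma_finite) AE_pair_fst:
  assumes "AE x in M1. P x"
  shows "AE p in M1 \<Otimes>\<^sub>M M2. P (fst p)"
proof -
  obtain N where N: "{x \<in> space M1. \<not> P x} \<subseteq> N" "emeasure M1 N = 0" and [measurable]: "N \<in> sets M1"
    using assms by (auto elim!: AE_E)
  have "AE x in M1. x \<notin> N"
    using N by (intro AE_not_in) auto
  then have "AE p in M1 \<Otimes>\<^sub>M M2. fst p \<notin> N"
    by (intro AE_pair_measure) auto
  then show ?thesis
  proof (rule AE_mp)
    show "AE p in M1 \<Otimes>\<^sub>M M2. fst p \<notin> N \<longrightarrow> P (fst p)"
      using N(1) by (intro AE_I2) (auto simp: space_pair_measure)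
  qed
qed

lemma (in pair_sigma_finite) AE_pair_snd:
  assumes "AE y in M2. P y"
  shows "AE p in M1 \<Otimes>\<^sub>M M2. P (snd p)"
proof -
  obtain N where N: "{x \<in> space M2. \<not> P x} \<subseteq> N" "emeasure M2 N = 0" and [measurable]: "N \<in> sets M2"
    using assms by (auto elim!: AE_E)
  have "AE x in M2. x \<notin> N"
    using N by (intro AE_not_in) auto
  then have "AE p in M1 \<Otimes>\<^sub>M M2. snd p \<notin> N"
    by (intro AE_pair_measure) auto
  then show ?thesis
  proof (rule AE_mp)
    show "AE p in M1 \<Otimes>\<^sub>M M2. snd p \<notin> N \<longrightarrow> P (snd p)"
      using N(1) by (intro AE_I2) (auto simp: space_pair_measure)
  qed
qed

section \<open>Periodic functions and the integer lattice\<close>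

definition lattice_cell :: "(real^3) set" where
  "lattice_cell = {z. \<forall>i. 0 \<le> z $ i \<and> z $ i < 1}"

definition integer_lattice :: "(real^3) set" where
  "integer_lattice = {k. \<forall>i. k $ i \<in> \<int>}"

lemma integer_lattice_altdef:
  "integer_lattice = range (\<lambda>n :: 3 \<Rightarrow> int. \<chi> i. of_int (n i))"
proof
  show "integer_lattice \<subseteq> range (\<lambda>n :: 3 \<Rightarrow> int. \<chi> i. of_int (n i))"
  proof
    fix k assume "k \<in> integer_lattice"
    then have "k = (\<chi> i. of_int ((\<lambda>i. \<lfloor>k $ i\<rfloor>) i))"
      unfolding integer_lattice_def vec_eq_iff by simp
    then show "k \<in> range (\<lambda>n :: 3 \<Rightarrow> int. \<chi> i. of_int (n i))"
      by (rule range_eqI[where x = "\<lambda>i. \<lfloor>k $ i\<rfloor>"])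
  qed
qed (auto simp: integer_lattice_def)

lemma countable_integer_lattice: "countable integer_lattice"
  unfolding integer_lattice_altdef by (intro countable_image countableI_type)

text \<open>
  The half-open cell tiles the space: the only lattice vector that moves \<open>x\<close> into it subtracts the
  integer parts of the coordinates.
\<close>

lemma lattice_cell_shift_unique:
  "{k \<in> integer_lattice. x + k \<in> lattice_cell} = {\<chi> i. - of_int \<lfloor>x $ i\<rfloor>}"
proof -
  have "k = (\<chi> i. - of_int \<lfloor>x $ i\<rfloor>)"
    if k: "k \<in> integer_lattice" "x + k \<in> lattice_cell" for k
  proof (rule vec_eq_iff[THEN iffD2], rule allI)
    fix i
    obtain n where n: "k $ i = of_int n"
      using k(1) unfolding integer_lattice_def by (auto elim: Ints_cases)
    have "0 \<le> (x + k) $ i \<and> (x + k) $ i < 1"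
      using k(2) unfolding lattice_cell_def by blast
    then have "\<lfloor>x $ i\<rfloor> = - n"
      unfolding vector_add_component n by linarith
    then show "k $ i = (\<chi> i. - of_int \<lfloor>x $ i\<rfloor>) $ i" using n by simp
  qed
  moreover have "(\<chi> i. - of_int \<lfloor>x $ i\<rfloor>) \<in> integer_lattice"
    by (simp add: integer_lattice_def)
  moreover have "x + (\<chi> i. - of_int \<lfloor>x $ i\<rfloor>) \<in> lattice_cell"
    by (simp add: lattice_cell_def) linarith
  ultimately show ?thesis by blast
qed

lemma sum_lattice_cell_shifts:
  "(\<integral>\<^sup>+ k. indicator lattice_cell (x + k) \<partial>count_space integer_lattice) = 1"
proof -
  have "(\<integral>\<^sup>+ k. indicator lattice_cell (x + k) \<partial>count_space integer_lattice) =
        (\<integral>\<^sup>+ k. indicator {k \<in> integer_lattice. x + k \<in> lattice_cell} k \<partial>count_space integer_lattice)"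
    by (intro nn_integral_cong) (auto simp: indicator_def)
  also have "\<dots> = emeasure (count_space integer_lattice) {k \<in> integer_lattice. x + k \<in> lattice_cell}"
    by (intro nn_integral_indicator) auto
  also have "\<dots> = 1"
    using lattice_cell_shift_unique[of x]
    by (subst emeasure_count_space_finite) auto
  finally show ?thesis .
qed

lemma ae_period_add: "ae_period p f \<Longrightarrow> ae_period q f \<Longrightarrow> ae_period (p + q) f"
  unfolding ae_period_def
proof -
  assume p: "AE x in lborel. f (x + p) = f x" and q: "AE x in lborel. f (x + q) = f x"
  from AE_lborel_translate[OF q, of p] p show "AE x in lborel. f (x + (p + q)) = f x"
    by eventually_elim (simp add: add.assoc)
qed

lemma ae_period_minus: "ae_period p f \<Longrightarrow> ae_period (- p) f"
  unfolding ae_period_def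
proof -
  assume p: "AE x in lborel. f (x + p) = f x"
  from AE_lborel_translate[OF p, of "- p"] show "AE x in lborel. f (x + - p) = f x"
    by eventually_elim simp
qed

lemma ae_period_of_int: "ae_period p f \<Longrightarrow> ae_period (of_int n *\<^sub>R p) f"
proof (induction n rule: int_induct[where k = 0])
  case base
  show ?case by (simp add: ae_period_def)
next
  case (step1 i)
  then show ?case using ae_period_add[of "of_int i *\<^sub>R p" f p] by (simp add: scaleR_add_left)
next
  case (step2 i)
  then show ?case using ae_period_add[of "of_int i *\<^sub>R p" f "- p"] ae_period_minus[of p f]
    by (simp add: scaleR_diff_left)
qed

text \<open>
  Almost-everywhere periods form an additive group, because a translation of a null set is null.
\<close>

lemma Q_periodic_lattice:
  assumes f: "Q_periodic f" and k: "k \<in> integer_lattice"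
  shows "ae_period k f"
proof -
  have sum: "ae_period (\<Sum>i\<in>I. k $ i *\<^sub>R axis i 1) f" for I :: "3 set"
  proof (induction I rule: infinite_finite_induct)
    case (insert i I)
    obtain n where "k $ i = of_int n"
      using k by (auto simp: integer_lattice_def elim: Ints_cases)
    then have "ae_period (k $ i *\<^sub>R axis i 1) f"
      using f unfolding Q_periodic_def by (simp add: ae_period_of_int)
    then show ?case using insert by (simp add: ae_period_add)
  qed (simp_all add: ae_period_def)
  show ?thesis
    using sum[of UNIV] unfolding basis_expansion[of k, unfolded scalar_mult_eq_scaleR] .
qed

lemma lattice_cell_measurable[measurable]: "lattice_cell \<in> sets borel"
  unfolding lattice_cell_def by measurable

lemma one_inner_Basis: "b \<in> Basis \<Longrightarrow> (1 :: real^'n) \<bullet> b = 1"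
  by (auto simp: Basis_vec_def inner_axis)

lemma unit_cube_box: "unit_cube = box 0 1"
  by (auto simp: unit_cube_def mem_box_cart)

lemma unit_cube_measurable[measurable]: "unit_cube \<in> sets borel"
  by (simp add: unit_cube_box)

lemma emeasure_unit_cube: "emeasure lborel unit_cube = 1"
  unfolding unit_cube_box
  by (simp add: emeasure_lborel_box_eq one_inner_Basis)

lemma AE_unit_cube_iff_lattice_cell: "AE z in lborel. z \<in> unit_cube \<longleftrightarrow> z \<in> lattice_cell"
proof -
  have c: "emeasure lborel (cbox 0 1 :: (real^3) set) = 1"
    by (simp add: emeasure_lborel_cbox_eq one_inner_Basis)
  have "emeasure lborel (cbox 0 1 - unit_cube) = 0"
    using emeasure_unit_cube c
    by (subst emeasure_Diff) (auto simp: unit_cube_box box_subset_cbox)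
  then have "AE z in lborel. z \<notin> cbox 0 1 - unit_cube"
    by (intro AE_not_in) (auto simp: null_sets_def)
  then show ?thesis
  proof eventually_elim
    case (elim z)
    have "unit_cube \<subseteq> lattice_cell" "lattice_cell \<subseteq> cbox 0 1"
      by (auto simp: unit_cube_def lattice_cell_def mem_box_cart less_imp_le)
    with elim show ?case by blast
  qed
qed

text \<open>
  Cutting the shifted cell along the integer lattice and moving each piece back by its lattice
  vector, which does not change \<open>f\<close>, reassembles the cell itself. In the computation below the cut is
  the insertion of \<open>\<Sum>\<^sub>k indicator lattice_cell (z + k) = 1\<close>, the motion is the substitution
  \<open>z \<mapsto> z - k\<close>, and the reassembly is the same tiling identity around the shifted point.
\<close>

lemma nn_integral_periodic_shift:
  fixes f :: "real^3 \<Rightarrow> ennreal"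
  assumes [measurable]: "f \<in> borel_measurable borel" and f: "Q_periodic f"
  shows "(\<integral>\<^sup>+ z\<in>unit_cube. f (z + \<xi>) \<partial>lborel) = (\<integral>\<^sup>+ z\<in>unit_cube. f z \<partial>lborel)"
proof -
  let ?K = "count_space integer_lattice" and ?C = "indicator lattice_cell :: real^3 \<Rightarrow> ennreal"
  have cell: "(\<integral>\<^sup>+ z\<in>unit_cube. g z \<partial>lborel) = (\<integral>\<^sup>+ z. g z * ?C z \<partial>lborel)" for g :: "real^3 \<Rightarrow> ennreal"
    using AE_unit_cube_iff_lattice_cell
    by (intro nn_integral_cong_AE) (auto elim!: eventually_mono simp: indicator_def)
  have "(\<integral>\<^sup>+ z. f (z + \<xi>) * ?C z \<partial>lborel) = (\<integral>\<^sup>+ z. f z * ?C (z - \<xi>) \<partial>lborel)"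
    using nn_integral_lborel_translate[of "\<lambda>z. f z * ?C (z - \<xi>)" \<xi>] by simp
  also have "\<dots> = (\<integral>\<^sup>+ z. (\<integral>\<^sup>+ k. f z * ?C (z - \<xi>) * ?C (z + k) \<partial>?K) \<partial>lborel)"
    by (simp add: nn_integral_cmult sum_lattice_cell_shifts)
  also have "\<dots> = (\<integral>\<^sup>+ k. (\<integral>\<^sup>+ z. f z * ?C (z - \<xi>) * ?C (z + k) \<partial>lborel) \<partial>?K)"
    by (intro nn_integral_count_space_nn_integral countable_integer_lattice) measurable
  also have "\<dots> = (\<integral>\<^sup>+ k. (\<integral>\<^sup>+ z. f z * ?C (z - \<xi> - k) * ?C z \<partial>lborel) \<partial>?K)"
  proof (rule nn_integral_cong)
    fix k assume "k \<in> space ?K"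
    then have "ae_period (- k) f"
      by (intro ae_period_minus Q_periodic_lattice[OF f]) simp
    then have "AE z in lborel. f (z - k) = f z"
      by (simp add: ae_period_def)
    then have "(\<integral>\<^sup>+ z. f z * ?C (z - \<xi> - k) * ?C z \<partial>lborel) =
        (\<integral>\<^sup>+ z. f (z - k) * ?C (z - \<xi> - k) * ?C z \<partial>lborel)"
      by (intro nn_integral_cong_AE) (auto elim!: eventually_mono)
    also have "\<dots> = (\<integral>\<^sup>+ z. f z * ?C (z - \<xi>) * ?C (z + k) \<partial>lborel)"
      using nn_integral_lborel_translate[of "\<lambda>z. f z * ?C (z - \<xi>) * ?C (z + k)" "- k"]
      by (simp add: algebra_simps)
    finally show "(\<integral>\<^sup>+ z. f z * ?C (z - \<xi>) * ?C (z + k) \<partial>lborel) =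
        (\<integral>\<^sup>+ z. f z * ?C (z - \<xi> - k) * ?C z \<partial>lborel)" by simp
  qed
  also have "\<dots> = (\<integral>\<^sup>+ z. (\<integral>\<^sup>+ k. f z * ?C (z - \<xi> - k) * ?C z \<partial>?K) \<partial>lborel)"
    by (intro nn_integral_count_space_nn_integral[symmetric] countable_integer_lattice) measurable
  also have "\<dots> = (\<integral>\<^sup>+ z. f z * ?C z \<partial>lborel)"
  proof (rule nn_integral_cong)
    fix z
    have "bij_betw uminus integer_lattice integer_lattice"
      by (rule bij_betwI[where g = uminus]) (auto simp: integer_lattice_def)
    then have "(\<integral>\<^sup>+ k. ?C (z - \<xi> - k) \<partial>?K) = (\<integral>\<^sup>+ k. ?C (z - \<xi> + k) \<partial>?K)"
      using nn_integral_bij_count_space[of uminus integer_lattice integer_lattice "\<lambda>k. ?C (z - \<xi> + k)"]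
      by simp
    then have "(\<integral>\<^sup>+ k. ?C (z - \<xi> - k) \<partial>?K) = 1"
      by (simp add: sum_lattice_cell_shifts)
    moreover have "(\<integral>\<^sup>+ k. f z * ?C (z - \<xi> - k) * ?C z \<partial>?K) =
        (\<integral>\<^sup>+ k. (f z * ?C z) * ?C (z - \<xi> - k) \<partial>?K)"
      by (simp add: mult_ac)
    ultimately show "(\<integral>\<^sup>+ k. f z * ?C (z - \<xi> - k) * ?C z \<partial>?K) = f z * ?C z"
      by (simp add: nn_integral_cmult)
  qed
  finally show ?thesis
    by (simp add: cell)
qed

lemma AE_periodic_from_cube:
  assumes P: "Q_periodic P" and [measurable]: "Measurable.pred borel P"
    and cube: "AE z in lborel. z \<in> unit_cube \<longrightarrow> P z"
  shows "AE z in lborel. P z"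
proof -
  let ?C = "indicator lattice_cell :: real^3 \<Rightarrow> ennreal"
  have "AE z in lborel. \<forall>k\<in>integer_lattice. z + k \<in> lattice_cell \<longrightarrow> P z"
  proof (rule AE_ball_countable'[OF _ countable_integer_lattice])
    fix k assume k: "k \<in> integer_lattice"
    have "AE z in lborel. z \<in> lattice_cell \<longrightarrow> P z"
      using AE_unit_cube_iff_lattice_cell cube by eventually_elim simp
    from AE_lborel_translate[OF this, of k] Q_periodic_lattice[OF P k, unfolded ae_period_def]
    show "AE z in lborel. z + k \<in> lattice_cell \<longrightarrow> P z"
      by eventually_elim simp
  qed
  then show ?thesis
    using lattice_cell_shift_unique by (auto elim!: eventually_mono)
qed

section \<open>Square-integrable functions\<close>

definition sq_integrable :: "'a measure \<Rightarrow> ('a \<Rightarrow> 'b::euclidean_space) \<Rightarrow> bool" where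
  "sq_integrable M f \<longleftrightarrow> f \<in> borel_measurable M \<and> integrable M (\<lambda>x. (norm (f x))\<^sup>2)"

lemma sq_integrable_iff_nn_integral:
  assumes [measurable]: "f \<in> borel_measurable M"
  shows "sq_integrable M f \<longleftrightarrow> (\<integral>\<^sup>+ x. ennreal ((norm (f x))\<^sup>2) \<partial>M) < \<infinity>"
  unfolding sq_integrable_def by (subst integrable_iff_bounded) simp

lemma nn_integral_sq_norm:
  "sq_integrable M f \<Longrightarrow> (\<integral>\<^sup>+ x. ennreal ((norm (f x))\<^sup>2) \<partial>M) = ennreal (LINT x|M. (norm (f x))\<^sup>2)"
  by (intro nn_integral_eq_integral) (auto simp: sq_integrable_def)

lemma sq_norm_add_le: "(norm (x + y :: 'a::real_normed_vector))\<^sup>2 \<le> 2 * (norm x)\<^sup>2 + 2 * (norm y)\<^sup>2"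
proof -
  have "(norm (x + y))\<^sup>2 \<le> (norm x + norm y)\<^sup>2"
    by (intro power_mono norm_triangle_ineq) simp
  also have "\<dots> \<le> 2 * (norm x)\<^sup>2 + 2 * (norm y)\<^sup>2"
    using zero_le_power2[of "norm x - norm y"] by (simp add: power2_eq_square algebra_simps)
  finally show ?thesis .
qed

lemma sq_integrable_add:
  assumes "sq_integrable M f" "sq_integrable M g"
  shows "sq_integrable M (\<lambda>x. f x + g x)"
proof -
  have [measurable]: "f \<in> borel_measurable M" "g \<in> borel_measurable M"
    using assms by (auto simp: sq_integrable_def)
  have "integrable M (\<lambda>x. 2 * (norm (f x))\<^sup>2 + 2 * (norm (g x))\<^sup>2)"
    using assms by (auto simp: sq_integrable_def)
  then have "integrable M (\<lambda>x. (norm (f x + g x))\<^sup>2)"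
    by (rule Bochner_Integration.integrable_bound) (measurable, simp add: sq_norm_add_le)
  then show ?thesis by (simp add: sq_integrable_def)
qed

lemma sq_integrable_bounded_linear:
  assumes "sq_integrable M f" "bounded_linear L"
  shows "sq_integrable M (\<lambda>x. L (f x))"
proof -
  have [measurable]: "f \<in> borel_measurable M"
    using assms by (auto simp: sq_integrable_def)
  have L[measurable]: "L \<in> borel_measurable borel"
    using assms(2) by (intro borel_measurable_continuous_onI linear_continuous_on)
  obtain K where K: "\<And>x. norm (L x) \<le> norm x * K" 
    using bounded_linear.bounded[OF assms(2)] by blast
  have bd: "(norm (L x))\<^sup>2 \<le> K\<^sup>2 * (norm x)\<^sup>2" for x
    using power_mono[OF K, of x 2] by (simp add: power_mult_distrib mult.commute)
  have int: "integrable M (\<lambda>x. K\<^sup>2 * (norm (f x))\<^sup>2)"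
    using assms(1) by (simp add: sq_integrable_def)
  have "integrable M (\<lambda>x. (norm (L (f x)))\<^sup>2)"
    by (rule Bochner_Integration.integrable_bound[OF int]) (measurable, simp add: bd)
  then show ?thesis by (simp add: sq_integrable_def)
qed

lemma sq_integrable_scaleR:
  "sq_integrable M f \<Longrightarrow> sq_integrable M (\<lambda>x. c *\<^sub>R f x)"
  by (rule sq_integrable_bounded_linear[OF _ bounded_linear_scaleR_right])

lemma sq_integrable_diff:
  "sq_integrable M f \<Longrightarrow> sq_integrable M g \<Longrightarrow> sq_integrable M (\<lambda>x. f x - g x)"
  using sq_integrable_add[OF _ sq_integrable_scaleR, of M f g "-1"] by simp

lemma sq_integrable_zero: "sq_integrable M (\<lambda>x. 0)"
  by (simp add: sq_integrable_def)

lemma sq_integrable_inner: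
  fixes f g :: "'a \<Rightarrow> 'b::euclidean_space"
  assumes "sq_integrable M f" "sq_integrable M g"
  shows "integrable M (\<lambda>x. f x \<bullet> g x)"
proof -
  have [measurable]: "f \<in> borel_measurable M" "g \<in> borel_measurable M"
    using assms by (auto simp: sq_integrable_def)
  have int: "integrable M (\<lambda>x. (norm (f x))\<^sup>2 + (norm (g x))\<^sup>2)"
    using assms by (auto simp: sq_integrable_def)
  have bd: "\<bar>x \<bullet> y\<bar> \<le> (norm x)\<^sup>2 + (norm y)\<^sup>2" for x y :: 'b
  proof -
    have "\<bar>x \<bullet> y\<bar> \<le> norm x * norm y" by (rule Cauchy_Schwarz_ineq2)
    also have "\<dots> \<le> (norm x)\<^sup>2 + (norm y)\<^sup>2"
      using zero_le_power2[of "norm x - norm y"] zero_le_power2[of "norm x"] zero_le_power2[of "norm y"]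
      unfolding power2_diff by linarith
    finally show ?thesis .
  qed
  show ?thesis
    by (rule Bochner_Integration.integrable_bound[OF int]) (measurable, simp add: bd)
qed

lemma sq_integrable_imp_integrable:
  fixes f :: "'a \<Rightarrow> 'b::euclidean_space"
  assumes "finite_measure M" "sq_integrable M f"
  shows "integrable M f"
proof -
  interpret finite_measure M by fact
  have [measurable]: "f \<in> borel_measurable M"
    using assms by (auto simp: sq_integrable_def)
  have int: "integrable M (\<lambda>x. 1 + (norm (f x))\<^sup>2)"
    using assms by (auto simp: sq_integrable_def)
  have bd: "norm x \<le> 1 + (norm x)\<^sup>2" for x :: 'b
    using zero_le_power2[of "norm x - 1"] zero_le_power2[of "norm x"] unfolding power2_diff by (simp; linarith)
  show ?thesis
    by (rule Bochner_Integration.integrable_bound[OF int]) (measurable, simp add: bd)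
qed

lemma integral_sq_norm_add:
  assumes "sq_integrable M f" "sq_integrable M g"
  shows "(LINT x|M. (norm (f x + t *\<^sub>R g x))\<^sup>2) =
    (LINT x|M. (norm (f x))\<^sup>2) + 2 * t * (LINT x|M. f x \<bullet> g x) + t\<^sup>2 * (LINT x|M. (norm (g x))\<^sup>2)"
proof -
  have "(norm (f x + t *\<^sub>R g x))\<^sup>2 = (norm (f x))\<^sup>2 + 2 * t * (f x \<bullet> g x) + t\<^sup>2 * (norm (g x))\<^sup>2" for x
    by (simp only: power2_norm_eq_inner)
       (simp add: inner_add_left inner_add_right inner_commute power2_eq_square algebra_simps)
  moreover have "integrable M (\<lambda>x. (norm (f x))\<^sup>2)" "integrable M (\<lambda>x. (norm (g x))\<^sup>2)"
    using assms by (auto simp: sq_integrable_def)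
  ultimately show ?thesis
    using sq_integrable_inner[OF assms] by simp
qed

text \<open>
  First variation: the squared norm of \<open>f + t g\<close> is a quadratic polynomial in \<open>t\<close> with its minimum
  at 0, so its linear coefficient vanishes.
\<close>

lemma orthogonal_if_minimal:
  assumes f: "sq_integrable M f" and g: "sq_integrable M g"
    and min: "\<And>t. (LINT x|M. (norm (f x))\<^sup>2) \<le> (LINT x|M. (norm (f x + t *\<^sub>R g x))\<^sup>2)"
  shows "(LINT x|M. f x \<bullet> g x) = 0"
proof -
  let ?b = "LINT x|M. f x \<bullet> g x" and ?c = "LINT x|M. (norm (g x))\<^sup>2"
  have c: "?c \<ge> 0" by simp
  have "0 \<le> 2 * t * ?b + t\<^sup>2 * ?c" for t
    using min[of t] unfolding integral_sq_norm_add[OF f g] by simp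
  \<comment> \<open>The step \<open>-b/c\<close> would be optimal; adding 1 to the denominator covers \<open>c = 0\<close>.\<close>
  moreover define u where "u = ?b / (?c + 1)"
  ultimately have *: "0 \<le> 2 * (- u) * ?b + (- u)\<^sup>2 * ?c"
    by blast
  have "?c + 1 \<noteq> 0"
    using c by linarith
  then have b: "?b = u * (?c + 1)"
    by (simp add: u_def)
  have "u\<^sup>2 * (?c + 2) \<le> 0"
    using * unfolding b by (simp add: power2_eq_square algebra_simps)
  then have "u = 0"
    using c by (simp add: mult_le_0_iff)
  then have "?b = 0"
    using b by simp
  then show ?thesis by simp
qed

section \<open>Mean-zero periodic functions on the unit cube\<close>

text \<open>
  A density rather than a restricted space: the sigma-algebra stays the Borel one, so that
  measurability of functions on the whole space carries over.
\<close>

definition cube_measure :: "(real^3) measure" where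
  "cube_measure = density lborel (indicator unit_cube)"

lemma sets_cube_measure[simp, measurable_cong]: "sets cube_measure = sets borel"
  by (simp add: cube_measure_def)

lemma space_cube_measure[simp]: "space cube_measure = UNIV"
  by (simp add: cube_measure_def)

lemma prob_space_cube_measure: "prob_space cube_measure"
  by standard (simp add: cube_measure_def emeasure_density emeasure_unit_cube)

interpretation cube: prob_space cube_measure
  by (rule prob_space_cube_measure)

interpretation cell: pair_sigma_finite cube_measure lborel ..

interpretation cube_square: pair_sigma_finite cube_measure cube_measure ..

lemma nn_integral_cube:
  "f \<in> borel_measurable borel \<Longrightarrow> (\<integral>\<^sup>+ z. f z \<partial>cube_measure) = (\<integral>\<^sup>+ z\<in>unit_cube. f z \<partial>lborel)"
  by (simp add: cube_measure_def nn_integral_density mult.commute)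

lemma integrable_cube:
  fixes f :: "real^3 \<Rightarrow> 'b::{banach, second_countable_topology}"
  assumes "f \<in> borel_measurable borel"
  shows "integrable cube_measure f \<longleftrightarrow> set_integrable lborel unit_cube f"
proof -
  have "integrable (density lborel (\<lambda>x. ennreal (indicator unit_cube x))) f \<longleftrightarrow>
      integrable lborel (\<lambda>x. indicator unit_cube x *\<^sub>R f x)"
    using assms by (intro integrable_density) auto
  then show ?thesis by (simp add: cube_measure_def set_integrable_def ennreal_indicator)
qed

lemma integral_cube:
  fixes f :: "real^3 \<Rightarrow> 'b::{banach, second_countable_topology}"
  assumes "f \<in> borel_measurable borel"
  shows "integral\<^sup>L cube_measure f = (LINT z:unit_cube|lborel. f z)"
proof -
  have "integral\<^sup>L (density lborel (\<lambda>x. ennreal (indicator unit_cube x))) f =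
      (LINT x|lborel. indicator unit_cube x *\<^sub>R f x)"
    using assms by (intro integral_density) auto
  then show ?thesis by (simp add: cube_measure_def set_lebesgue_integral_def ennreal_indicator)
qed

lemma AE_cube_iff: "(AE z in cube_measure. P z) \<longleftrightarrow> (AE z in lborel. z \<in> unit_cube \<longrightarrow> P z)"
  unfolding cube_measure_def by (subst AE_density) (auto simp: indicator_def)

lemma AE_cube: "(AE z in lborel. P z) \<Longrightarrow> (AE z in cube_measure. P z)"
  unfolding AE_cube_iff by (auto elim!: eventually_mono)

lemma nn_integral_cube_shift:
  "f \<in> borel_measurable borel \<Longrightarrow> Q_periodic f \<Longrightarrow>
   (\<integral>\<^sup>+ z. f (z + \<xi>) \<partial>cube_measure) = (\<integral>\<^sup>+ z. f z \<partial>cube_measure)"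
  by (simp add: nn_integral_cube nn_integral_periodic_shift)

lemma Q_periodic_comp2:
  assumes "Q_periodic v" "Q_periodic w"
  shows "Q_periodic (\<lambda>z. h (v z) (w z))"
  unfolding Q_periodic_def ae_period_def
proof
  fix i
  have "AE z in lborel. v (z + axis i 1) = v z" "AE z in lborel. w (z + axis i 1) = w z"
    using assms by (auto simp: Q_periodic_def ae_period_def)
  then show "AE z in lborel. h (v (z + axis i 1)) (w (z + axis i 1)) = h (v z) (w z)"
    by eventually_elim simp
qed

lemma Q_periodic_comp: "Q_periodic v \<Longrightarrow> Q_periodic (\<lambda>z. h (v z))"
  using Q_periodic_comp2[of v v "\<lambda>a b. h a"] by simp

lemma Q_periodic_shift:
  assumes "Q_periodic v"
  shows "Q_periodic (\<lambda>z. v (z + \<xi>))"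
  unfolding Q_periodic_def ae_period_def
proof
  fix i
  have "AE z in lborel. v (z + axis i 1) = v z"
    using assms by (auto simp: Q_periodic_def ae_period_def)
  from AE_lborel_translate[OF this, of \<xi>]
  show "AE z in lborel. v (z + axis i 1 + \<xi>) = v (z + \<xi>)"
    by (simp add: add_ac)
qed

lemma L2_per0_iff:
  "v \<in> L2_per0 V \<longleftrightarrow> v \<in> borel_measurable borel \<and> (AE z in lborel. v z \<in> V) \<and> Q_periodic v \<and>
     sq_integrable cube_measure v \<and> integral\<^sup>L cube_measure v = 0"
proof (cases "v \<in> borel_measurable borel")
  case True
  then have "v \<in> borel_measurable cube_measure" by simp
  moreover have "(\<lambda>z. (norm (v z))\<^sup>2) \<in> borel_measurable borel" using True by measurable
  ultimately show ?thesis
    using True by (simp add: L2_per0_def sq_integrable_def integrable_cube integral_cube)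
qed (simp add: L2_per0_def)

lemma integrable_cube_L2_per0: "v \<in> L2_per0 V \<Longrightarrow> integrable cube_measure v"
  unfolding L2_per0_iff
  by (intro sq_integrable_imp_integrable) (auto intro: cube.finite_measure_axioms)

lemma zero_L2_per0: "subspace V \<Longrightarrow> (\<lambda>z. 0) \<in> L2_per0 V"
  by (simp add: L2_per0_iff sq_integrable_zero subspace_0 Q_periodic_def ae_period_def)

lemma add_L2_per0:
  assumes V: "subspace V" and v: "v \<in> L2_per0 V" and w: "w \<in> L2_per0 V"
  shows "(\<lambda>z. v z + w z) \<in> L2_per0 V"
proof -
  have "AE z in lborel. v z \<in> V" "AE z in lborel. w z \<in> V"
    using v w by (auto simp: L2_per0_iff)
  then have "AE z in lborel. v z + w z \<in> V"
    by eventually_elim (rule subspace_add[OF V])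
  then show ?thesis
    using v w integrable_cube_L2_per0[OF v] integrable_cube_L2_per0[OF w]
    by (auto simp: L2_per0_iff sq_integrable_add intro: Q_periodic_comp2)
qed

lemma linear_image_L2_per0:
  assumes v: "v \<in> L2_per0 V" and L: "linear L" "\<And>x. x \<in> V \<Longrightarrow> L x \<in> W"
  shows "(\<lambda>z. L (v z)) \<in> L2_per0 W"
proof -
  have bl: "bounded_linear L" using L(1) by (simp add: linear_conv_bounded_linear)
  then have [measurable]: "L \<in> borel_measurable borel"
    by (intro borel_measurable_continuous_onI linear_continuous_on)
  have "AE z in lborel. L (v z) \<in> W"
    using v L(2) by (auto simp: L2_per0_iff elim!: eventually_mono)
  moreover have "integral\<^sup>L cube_measure (\<lambda>z. L (v z)) = L 0"
    using v integral_bounded_linear[OF bl integrable_cube_L2_per0[OF v]] by (simp add: L2_per0_iff)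
  ultimately show ?thesis
    using v sq_integrable_bounded_linear[OF _ bl, of cube_measure v] linear_0[OF L(1)]
    by (auto simp: L2_per0_iff intro: Q_periodic_comp)
qed

lemma scaleR_L2_per0: "subspace V \<Longrightarrow> v \<in> L2_per0 V \<Longrightarrow> (\<lambda>z. c *\<^sub>R v z) \<in> L2_per0 V"
  by (erule linear_image_L2_per0) (auto simp: subspace_scale linear_iff scaleR_add_right)

lemma diff_L2_per0:
  "subspace V \<Longrightarrow> v \<in> L2_per0 V \<Longrightarrow> w \<in> L2_per0 V \<Longrightarrow> (\<lambda>z. v z - w z) \<in> L2_per0 V"
  using add_L2_per0[of V v "\<lambda>z. (-1) *\<^sub>R w z"] scaleR_L2_per0[of V w "-1"] by simp

section \<open>A nonlocal Poincare inequality\<close>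

text \<open>
  The domain of integration of all the energies: base point \<open>z\<close> in the cube, increment \<open>\<xi>\<close> in the
  whole space.
\<close>

definition cell_measure :: "((real^3) \<times> (real^3)) measure" where
  "cell_measure = cube_measure \<Otimes>\<^sub>M lborel"

lemma sets_cell_measure[measurable_cong]: "sets cell_measure = sets (borel \<Otimes>\<^sub>M borel)"
  unfolding cell_measure_def by (intro sets_pair_measure_cong) auto

lemma nn_integral_cell:
  assumes "f \<in> borel_measurable (borel \<Otimes>\<^sub>M borel)"
  shows "(\<integral>\<^sup>+ p. f p \<partial>cell_measure) = (\<integral>\<^sup>+ \<xi>. (\<integral>\<^sup>+ z. f (z, \<xi>) \<partial>cube_measure) \<partial>lborel)"
proof -
  have "f \<in> borel_measurable (cube_measure \<Otimes>\<^sub>M lborel)" using assms by measurable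
  from cell.nn_integral_snd[OF this] show ?thesis
    by (simp add: cell_measure_def)
qed

text \<open>
  For \<open>v\<close> of mean zero, the mean of \<open>|v(y) - v(z)|\<^sup>2\<close> over \<open>y\<close> is \<open>|v(z)|\<^sup>2\<close> plus the mean of
  \<open>|v|\<^sup>2\<close>. This is the only place where the mean-zero condition enters the Poincare inequality.
\<close>

lemma sq_norm_le_mean_sq_difference:
  assumes v: "v \<in> L2_per0 V"
  shows "ennreal ((norm (v z))\<^sup>2) \<le> (\<integral>\<^sup>+ y. ennreal ((norm (v y - v z))\<^sup>2) \<partial>cube_measure)"
proof -
  have sq: "sq_integrable cube_measure v" and [measurable]: "v \<in> borel_measurable borel"
    and mean: "integral\<^sup>L cube_measure v = 0"
    using v by (auto simp: L2_per0_iff)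
  have const: "sq_integrable cube_measure (\<lambda>y. v z)"
    by (simp add: sq_integrable_def)
  have "(LINT y|cube_measure. (norm (v y - v z))\<^sup>2) =
      (LINT y|cube_measure. (norm (v y))\<^sup>2) - 2 * (LINT y|cube_measure. v y \<bullet> v z) + (norm (v z))\<^sup>2"
    using integral_sq_norm_add[OF sq const, of "-1"] cube.prob_space by simp
  also have "(LINT y|cube_measure. v y \<bullet> v z) = 0"
    using integrable_cube_L2_per0[OF v] mean by simp
  also have "(norm (v z))\<^sup>2 \<le> (LINT y|cube_measure. (norm (v y))\<^sup>2) - 2 * 0 + (norm (v z))\<^sup>2"
    by simp
  finally show ?thesis
    using nn_integral_sq_norm[OF sq_integrable_diff[OF sq const]] by (simp add: ennreal_leI)
qed

definition mean_sq_increment :: "(real^3 \<Rightarrow> real^3) \<Rightarrow> real^3 \<Rightarrow> ennreal" where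
  "mean_sq_increment v \<xi> = (\<integral>\<^sup>+ z. ennreal ((norm (v (z + \<xi>) - v z))\<^sup>2) \<partial>cube_measure)"

lemma mean_sq_increment_measurable[measurable]:
  assumes [measurable]: "v \<in> borel_measurable borel"
  shows "mean_sq_increment v \<in> borel_measurable borel"
  unfolding mean_sq_increment_def by measurable

text \<open>
  The increment over \<open>2\<xi>\<close> is the sum of two increments over \<open>\<xi>\<close>, based at \<open>z\<close> and at \<open>z + \<xi>\<close>; by
  periodicity both have the same mean square. Iterating this controls increments of unit size by
  increments of arbitrarily small size, which is all that the lower bound on the weight near the
  origin gives.
\<close>

lemma mean_sq_increment_double:
  assumes [measurable]: "v \<in> borel_measurable borel" and v: "Q_periodic v"
  shows "mean_sq_increment v (2 *\<^sub>R \<xi>) \<le> 4 * mean_sq_increment v \<xi>"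
proof -
  have "mean_sq_increment v (2 *\<^sub>R \<xi>) \<le>
      (\<integral>\<^sup>+ z. 2 * ennreal ((norm (v (z + \<xi> + \<xi>) - v (z + \<xi>)))\<^sup>2) +
            2 * ennreal ((norm (v (z + \<xi>) - v z))\<^sup>2) \<partial>cube_measure)"
    unfolding mean_sq_increment_def
  proof (rule nn_integral_mono)
    fix z
    have "(norm (v (z + 2 *\<^sub>R \<xi>) - v z))\<^sup>2 \<le>
        2 * (norm (v (z + \<xi> + \<xi>) - v (z + \<xi>)))\<^sup>2 + 2 * (norm (v (z + \<xi>) - v z))\<^sup>2"
      using sq_norm_add_le[of "v (z + \<xi> + \<xi>) - v (z + \<xi>)" "v (z + \<xi>) - v z"]
      by (simp add: scaleR_2 add.assoc)
    then have "ennreal ((norm (v (z + 2 *\<^sub>R \<xi>) - v z))\<^sup>2) \<le>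
        ennreal (2 * (norm (v (z + \<xi> + \<xi>) - v (z + \<xi>)))\<^sup>2 + 2 * (norm (v (z + \<xi>) - v z))\<^sup>2)"
      by (rule ennreal_leI)
    also have "\<dots> = 2 * ennreal ((norm (v (z + \<xi> + \<xi>) - v (z + \<xi>)))\<^sup>2) +
            2 * ennreal ((norm (v (z + \<xi>) - v z))\<^sup>2)"
      by (simp add: ennreal_plus ennreal_mult)
    finally show "ennreal ((norm (v (z + 2 *\<^sub>R \<xi>) - v z))\<^sup>2) \<le> \<dots>" .
  qed
  also have "\<dots> = 2 * (\<integral>\<^sup>+ z. ennreal ((norm (v (z + \<xi> + \<xi>) - v (z + \<xi>)))\<^sup>2) \<partial>cube_measure) +
      2 * mean_sq_increment v \<xi>"
    unfolding mean_sq_increment_def by (simp add: nn_integral_add nn_integral_cmult)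
  also have "(\<integral>\<^sup>+ z. ennreal ((norm (v (z + \<xi> + \<xi>) - v (z + \<xi>)))\<^sup>2) \<partial>cube_measure) =
      mean_sq_increment v \<xi>"
    unfolding mean_sq_increment_def
    by (intro nn_integral_cube_shift[of "\<lambda>z. ennreal ((norm (v (z + \<xi>) - v z))\<^sup>2)"]
          Q_periodic_comp2[where h = "\<lambda>a b. ennreal ((norm (a - b))\<^sup>2)"] Q_periodic_shift v) measurable
  also have "2 * mean_sq_increment v \<xi> + 2 * mean_sq_increment v \<xi> = 4 * mean_sq_increment v \<xi>"
    by (simp add: distrib_right[symmetric])
  finally show ?thesis .
qed

lemma mean_sq_increment_power2:
  assumes "v \<in> borel_measurable borel" "Q_periodic v"
  shows "mean_sq_increment v (2 ^ n *\<^sub>R \<xi>) \<le> 4 ^ n * mean_sq_increment v \<xi>"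
proof (induction n)
  case (Suc n)
  have "mean_sq_increment v (2 ^ Suc n *\<^sub>R \<xi>) \<le> 4 * mean_sq_increment v (2 ^ n *\<^sub>R \<xi>)"
    using mean_sq_increment_double[OF assms, of "2 ^ n *\<^sub>R \<xi>"] by simp
  also have "\<dots> \<le> 4 * (4 ^ n * mean_sq_increment v \<xi>)"
    by (intro mult_left_mono Suc) simp
  finally show ?case by (simp add: mult.assoc)
qed simp

lemma sq_norm_le_mean_sq_increments:
  assumes v: "v \<in> L2_per0 V"
  shows "(\<integral>\<^sup>+ z. ennreal ((norm (v z))\<^sup>2) \<partial>cube_measure) \<le>
    (\<integral>\<^sup>+ \<xi>. mean_sq_increment v \<xi> \<partial>cube_measure)"
proof -
  have [measurable]: "v \<in> borel_measurable borel" and per: "Q_periodic v"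
    using v by (auto simp: L2_per0_iff)
  have "(\<integral>\<^sup>+ z. ennreal ((norm (v z))\<^sup>2) \<partial>cube_measure) \<le>
      (\<integral>\<^sup>+ z. (\<integral>\<^sup>+ y. ennreal ((norm (v y - v z))\<^sup>2) \<partial>cube_measure) \<partial>cube_measure)"
    by (intro nn_integral_mono sq_norm_le_mean_sq_difference[OF v])
  also have "\<dots> = (\<integral>\<^sup>+ z. (\<integral>\<^sup>+ \<xi>. ennreal ((norm (v (\<xi> + z) - v z))\<^sup>2) \<partial>cube_measure) \<partial>cube_measure)"
    by (intro nn_integral_cong nn_integral_cube_shift[symmetric] Q_periodic_comp[OF per]) measurable
  also have "\<dots> = (\<integral>\<^sup>+ \<xi>. (\<integral>\<^sup>+ z. ennreal ((norm (v (\<xi> + z) - v z))\<^sup>2) \<partial>cube_measure) \<partial>cube_measure)"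
    by (rule cube_square.Fubini'[symmetric]) measurable
  finally show ?thesis
    by (simp add: mean_sq_increment_def add.commute)
qed

lemma norm_unit_cube: "z \<in> unit_cube \<Longrightarrow> norm z < 2"
proof -
  assume "z \<in> unit_cube"
  then have "(z $ i)\<^sup>2 \<le> 1" for i
    unfolding unit_cube_def by (intro power_le_one) (auto simp: less_imp_le)
  then have "(\<Sum>i\<in>UNIV. (z $ i)\<^sup>2) \<le> (\<Sum>i\<in>(UNIV :: 3 set). 1)"
    by (intro sum_mono)
  then have "(norm z)\<^sup>2 \<le> 3"
    by (simp add: norm_vec_def L2_set_def sum_nonneg)
  then have "(norm z)\<^sup>2 < 2\<^sup>2" by simp
  then show "norm z < 2" by (rule power_less_imp_less_base) simp
qed

text \<open>
  The unit cube lies in the ball of radius 2, and scaling by \<open>2\<^sup>n\<close> maps a ball of radius at most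
  \<open>r\<close> onto that ball. The factor is \<open>8\<^sup>n\<close> from the Jacobian in dimension 3 times \<open>4\<^sup>n\<close> from
  \<open>n\<close> doublings.
\<close>

lemma mean_sq_increments_le_ball:
  assumes [measurable]: "v \<in> borel_measurable borel" and v: "Q_periodic v" and n: "2 / 2 ^ n \<le> r"
  shows "(\<integral>\<^sup>+ \<xi>. mean_sq_increment v \<xi> \<partial>cube_measure) \<le>
    32 ^ n * (\<integral>\<^sup>+ \<xi>. mean_sq_increment v \<xi> * indicator (ball 0 r) \<xi> \<partial>lborel)"
proof -
  have "(\<integral>\<^sup>+ \<xi>. mean_sq_increment v \<xi> \<partial>cube_measure) \<le>
      (\<integral>\<^sup>+ \<xi>. mean_sq_increment v \<xi> * indicator (ball 0 2) \<xi> \<partial>lborel)"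
    by (auto simp: nn_integral_cube norm_unit_cube intro!: nn_integral_mono split: split_indicator)
  also have "\<dots> = 8 ^ n * (\<integral>\<^sup>+ \<xi>. mean_sq_increment v (2 ^ n *\<^sub>R \<xi>) * indicator (ball 0 2) (2 ^ n *\<^sub>R \<xi> :: real^3) \<partial>lborel)"
    by (subst nn_integral_lborel_scale[of _ "2 ^ n"])
       (measurable, simp_all add: power_mult[symmetric] mult.commute[of n] power_mult ennreal_power[symmetric])
  also have "\<dots> \<le> 8 ^ n * (\<integral>\<^sup>+ \<xi>. 4 ^ n * (mean_sq_increment v \<xi> * indicator (ball 0 r) \<xi>) \<partial>lborel)"
  proof (intro mult_left_mono nn_integral_mono)
    fix \<xi> :: "real^3"
    have "indicator (ball 0 2) (2 ^ n *\<^sub>R \<xi>) \<le> (indicator (ball 0 r) \<xi> :: ennreal)"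
    proof (cases "2 ^ n *\<^sub>R \<xi> \<in> ball 0 2")
      case True
      then have "norm \<xi> < 2 / 2 ^ n" by (simp add: field_simps)
      then show ?thesis using n by (simp add: indicator_def)
    qed simp
    then have "mean_sq_increment v (2 ^ n *\<^sub>R \<xi>) * indicator (ball 0 2) (2 ^ n *\<^sub>R \<xi>) \<le>
        (4 ^ n * mean_sq_increment v \<xi>) * indicator (ball 0 r) \<xi>"
      by (intro mult_mono mean_sq_increment_power2 v) auto
    then show "mean_sq_increment v (2 ^ n *\<^sub>R \<xi>) * indicator (ball 0 2) (2 ^ n *\<^sub>R \<xi>) \<le>
        4 ^ n * (mean_sq_increment v \<xi> * indicator (ball 0 r) \<xi>)"
      by (simp add: mult.assoc)
  qed simp
  also have "\<dots> = 32 ^ n * (\<integral>\<^sup>+ \<xi>. mean_sq_increment v \<xi> * indicator (ball 0 r) \<xi> \<partial>lborel)"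
  proof -
    have "(8 :: ennreal) ^ n * 4 ^ n = 32 ^ n"
      by (simp add: power_mult_distrib[symmetric])
    moreover have "ball 0 r \<in> sets (borel :: (real^3) measure)"
      by simp
    then have "(\<lambda>\<xi>. mean_sq_increment v \<xi> * indicator (ball 0 r) \<xi>) \<in> borel_measurable lborel"
      by measurable
    note nn_integral_cmult[OF this, of "4 ^ n"]
    ultimately show ?thesis
      by (simp only: mult.assoc[symmetric])
  qed
  finally show ?thesis .
qed

definition diff_quot :: "(real^3 \<Rightarrow> real^3) \<Rightarrow> (real^3) \<times> (real^3) \<Rightarrow> real^3" where
  "diff_quot v p = (v (fst p + snd p) - v (fst p)) /\<^sub>R norm (snd p)"

lemma diff_quot_measurable[measurable]:
  assumes [measurable]: "v \<in> borel_measurable borel"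
  shows "diff_quot v \<in> borel_measurable (borel \<Otimes>\<^sub>M borel)"
  unfolding diff_quot_def by measurable

lemma diff_quot_add: "diff_quot (\<lambda>z. v z + w z) p = diff_quot v p + diff_quot w p"
  by (simp add: diff_quot_def algebra_simps)

lemma diff_quot_diff: "diff_quot (\<lambda>z. v z - w z) p = diff_quot v p - diff_quot w p"
  by (simp add: diff_quot_def algebra_simps)

lemma diff_quot_linear: "linear L \<Longrightarrow> diff_quot (\<lambda>z. L (v z)) p = L (diff_quot v p)"
  by (simp add: diff_quot_def linear_diff linear_scale)

lemma diff_quot_scaleR: "diff_quot (\<lambda>z. c *\<^sub>R v z) p = c *\<^sub>R diff_quot v p"
  by (simp add: diff_quot_def algebra_simps)

lemma diff_quot_zero: "diff_quot (\<lambda>z. 0) p = 0"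
  by (simp add: diff_quot_def)

text \<open>
  A nonnegative weight that dominates \<open>c |\<xi>|\<^sup>2\<close> for increments shorter than \<open>r\<close>. The factor
  \<open>|\<xi>|\<^sup>2\<close> cancels the one in the difference quotient, so near the origin the weighted energy
  controls plain squared increments.
\<close>

locale nonlocal_weight =
  fixes m :: "(real^3) \<times> (real^3) \<Rightarrow> real" and c r :: real
  assumes m_measurable[measurable]: "m \<in> borel_measurable (borel \<Otimes>\<^sub>M borel)"
    and m_nonneg: "AE p in cell_measure. 0 \<le> m p"
    and c_pos: "0 < c" and r_pos: "0 < r"
    and m_lower: "AE p in cell_measure. norm (snd p) < r \<longrightarrow> c * (norm (snd p))\<^sup>2 \<le> m p"
begin

definition weighted :: "((real^3) \<times> (real^3)) measure" where
  "weighted = density cell_measure (\<lambda>p. ennreal (m p))"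

lemma sets_weighted[measurable_cong]: "sets weighted = sets (borel \<Otimes>\<^sub>M borel)"
  by (simp add: weighted_def sets_cell_measure)

lemma AE_weighted: "(AE p in cell_measure. P p) \<Longrightarrow> (AE p in weighted. P p)"
  unfolding weighted_def by (subst AE_density) (measurable, auto elim!: eventually_mono)

lemma nn_integral_weighted:
  assumes "f \<in> borel_measurable (borel \<Otimes>\<^sub>M borel)"
  shows "(\<integral>\<^sup>+ p. f p \<partial>weighted) = (\<integral>\<^sup>+ p. ennreal (m p) * f p \<partial>cell_measure)"
  using assms unfolding weighted_def by (intro nn_integral_density) measurable

text \<open>
  Coercivity: the squared norm of a mean-zero periodic \<open>v\<close> is at most the mean of its squared
  increments over the vectors of the unit cube, which is
  controlled through doubling by increments shorter than \<open>r\<close>, hence by the weighted energy. The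
  constant depends on the weight alone.
\<close>

lemma poincare:
  "\<exists>K::real. \<forall>V. \<forall>v\<in>L2_per0 V. (\<integral>\<^sup>+ z. ennreal ((norm (v z))\<^sup>2) \<partial>cube_measure) \<le>
     ennreal K * (\<integral>\<^sup>+ p. ennreal ((norm (diff_quot v p))\<^sup>2) \<partial>weighted)"
proof -
  obtain n where "2 / r < 2 ^ n"
    using real_arch_pow[of 2 "2 / r"] by auto
  then have n: "2 / 2 ^ n \<le> r"
    using r_pos by (simp add: field_simps)
  show ?thesis
  proof (intro exI[of _ "32 ^ n / c"] allI ballI)
    fix V v assume v: "v \<in> L2_per0 V"
    then have [measurable]: "v \<in> borel_measurable borel" and per: "Q_periodic v"
      by (auto simp: L2_per0_iff)
    have "(\<integral>\<^sup>+ \<xi>. mean_sq_increment v \<xi> * indicator (ball 0 r) \<xi> \<partial>lborel) =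
        (\<integral>\<^sup>+ \<xi>. (\<integral>\<^sup>+ z. ennreal ((norm (v (z + \<xi>) - v z))\<^sup>2) * indicator (ball 0 r) \<xi> \<partial>cube_measure) \<partial>lborel)"
      unfolding mean_sq_increment_def by (intro nn_integral_cong nn_integral_multc[symmetric]) measurable
    also have "\<dots> = (\<integral>\<^sup>+ p. ennreal ((norm (v (fst p + snd p) - v (fst p)))\<^sup>2) * indicator (ball 0 r) (snd p) \<partial>cell_measure)"
      by (subst nn_integral_cell) (measurable, simp_all)
    also have "\<dots> \<le> (\<integral>\<^sup>+ p. ennreal (1 / c) * (ennreal (m p) * ennreal ((norm (diff_quot v p))\<^sup>2)) \<partial>cell_measure)"
    proof (rule nn_integral_mono_AE)
      show "AE p in cell_measure. ennreal ((norm (v (fst p + snd p) - v (fst p)))\<^sup>2) * indicator (ball 0 r) (snd p) \<le>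
          ennreal (1 / c) * (ennreal (m p) * ennreal ((norm (diff_quot v p))\<^sup>2))"
        using m_nonneg m_lower
      proof eventually_elim
        case (elim p)
        show ?case
        proof (cases "norm (snd p) < r")
          case True
          have eq: "(norm (v (fst p + snd p) - v (fst p)))\<^sup>2 = (norm (snd p))\<^sup>2 * (norm (diff_quot v p))\<^sup>2"
            by (cases "snd p = 0") (simp_all add: diff_quot_def power_mult_distrib power_inverse flip: mult.assoc)
          have "(norm (snd p))\<^sup>2 \<le> 1 / c * m p"
            using elim True c_pos by (simp add: field_simps)
          then have "(norm (v (fst p + snd p) - v (fst p)))\<^sup>2 \<le> (1 / c * m p) * (norm (diff_quot v p))\<^sup>2"
            unfolding eq by (intro mult_right_mono) auto
          then have "ennreal ((norm (v (fst p + snd p) - v (fst p)))\<^sup>2) \<le>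
              ennreal (1 / c * (m p * (norm (diff_quot v p))\<^sup>2))"
            by (intro ennreal_leI) (simp add: mult.assoc)
          also have "\<dots> = ennreal (1 / c) * (ennreal (m p) * ennreal ((norm (diff_quot v p))\<^sup>2))"
            using elim c_pos by (simp only: ennreal_mult mult_nonneg_nonneg zero_le_power2 zero_le_divide_1_iff less_imp_le)
          finally show ?thesis
            using True by simp
        qed simp
      qed
    qed
    also have "\<dots> = ennreal (1 / c) * (\<integral>\<^sup>+ p. ennreal ((norm (diff_quot v p))\<^sup>2) \<partial>weighted)"
      by (subst nn_integral_cmult) (measurable, simp add: nn_integral_weighted)
    finally have "32 ^ n * (\<integral>\<^sup>+ \<xi>. mean_sq_increment v \<xi> * indicator (ball 0 r) \<xi> \<partial>lborel) \<le>
        32 ^ n * (ennreal (1 / c) * (\<integral>\<^sup>+ p. ennreal ((norm (diff_quot v p))\<^sup>2) \<partial>weighted))"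
      by (intro mult_left_mono) auto
    also have "\<dots> = ennreal (32 ^ n / c) * (\<integral>\<^sup>+ p. ennreal ((norm (diff_quot v p))\<^sup>2) \<partial>weighted)"
    proof -
      have "32 ^ n * ennreal (1 / c) = ennreal (32 ^ n / c)"
        using c_pos ennreal_mult[of "32 ^ n" "1 / c"] by (simp add: ennreal_power[symmetric])
      then show ?thesis by (simp add: mult.assoc[symmetric])
    qed
    finally show "(\<integral>\<^sup>+ z. ennreal ((norm (v z))\<^sup>2) \<partial>cube_measure) \<le>
        ennreal (32 ^ n / c) * (\<integral>\<^sup>+ p. ennreal ((norm (diff_quot v p))\<^sup>2) \<partial>weighted)"
      using sq_norm_le_mean_sq_increments[OF v] mean_sq_increments_le_ball[OF _ per n] 
      by (meson \<open>v \<in> borel_measurable borel\<close> order_trans)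
  qed
qed

end

section \<open>Almost everywhere limits\<close>

lemma AE_cell_measure:
  fixes P :: "(real^3) \<times> (real^3) \<Rightarrow> bool"
  assumes "AE p in lborel. P p"
  shows "AE p in cell_measure. P p"
proof -
  obtain N where N: "{p. \<not> P p} \<subseteq> N" "N \<in> sets lborel" "emeasure lborel N = 0"
    using assms by (auto elim!: AE_E)
  have [measurable]: "N \<in> sets (borel \<Otimes>\<^sub>M borel)"
    using N(2) unfolding sets_lborel borel_prod[symmetric] .
  have "AE p in lborel. p \<notin> N"
    using N by (intro AE_not_in) auto
  then have "AE p in lborel \<Otimes>\<^sub>M lborel. p \<notin> N"
    unfolding lborel_prod .
  then have "AE z in lborel. AE \<xi> in lborel. (z, \<xi>) \<notin> N"
    by (rule lborel_pair.AE_pair)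
  then have "AE z in cube_measure. AE \<xi> in lborel. (z, \<xi>) \<notin> N"
    by (rule AE_cube)
  then have "AE p in cell_measure. p \<notin> N"
    unfolding cell_measure_def by (intro cell.AE_pair_measure[rotated]) (simp, measurable)
  then show ?thesis
    using N(1) by (auto elim!: eventually_mono)
qed

text \<open>
  An almost everywhere property of points holds at both ends \<open>z\<close> and \<open>z + \<xi>\<close> of almost every
  increment; this transports almost everywhere convergence to difference quotients.
\<close>

lemma AE_cell_endpoints:
  assumes "AE z in lborel. P z"
  shows "AE p in cell_measure. P (fst p)" "AE p in cell_measure. P (fst p + snd p)"
proof -
  show "AE p in cell_measure. P (fst p)"
    unfolding cell_measure_def by (intro cell.AE_pair_fst AE_cube assms)
  have "AE p in lborel \<Otimes>\<^sub>M lborel :: ((real^3) \<times> (real^3)) measure. P (snd p)"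
    by (intro lborel_pair.AE_pair_snd assms)
  then have "AE p in lborel :: ((real^3) \<times> (real^3)) measure. P (snd p)"
    unfolding lborel_prod .
  from AE_cell_measure[OF AE_lborel_shear[OF this]]
  show "AE p in cell_measure. P (fst p + snd p)" by simp
qed

text \<open>
  The form of Fatou's lemma used for lower semicontinuity.
\<close>

lemma nn_integral_le_of_AE_limit:
  fixes f :: "nat \<Rightarrow> 'a \<Rightarrow> ennreal"
  assumes [measurable]: "\<And>n. f n \<in> borel_measurable M"
    and lim: "AE x in M. (\<lambda>n. f n x) \<longlonglongrightarrow> g x"
    and le: "\<forall>\<^sub>F n in sequentially. (\<integral>\<^sup>+ x. f n x \<partial>M) \<le> b n" and b: "b \<longlonglongrightarrow> B"
  shows "(\<integral>\<^sup>+ x. g x \<partial>M) \<le> B"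
proof -
  have "(\<integral>\<^sup>+ x. g x \<partial>M) = (\<integral>\<^sup>+ x. liminf (\<lambda>n. f n x) \<partial>M)"
    using lim by (intro nn_integral_cong_AE) (auto elim!: eventually_mono simp: lim_imp_Liminf)
  also have "\<dots> \<le> liminf (\<lambda>n. \<integral>\<^sup>+ x. f n x \<partial>M)"
    by (rule nn_integral_liminf) simp
  also have "\<dots> \<le> liminf b"
    by (rule Liminf_mono[OF le])
  also have "\<dots> = B"
    by (intro lim_imp_Liminf b) simp
  finally show ?thesis .
qed

text \<open>
  By Young's inequality \<open>|f| \<le> 4\<^sup>n |f|\<^sup>2 + 4\<^sup>-\<^sup>n\<close>: a geometric bound on second moments gives
  a geometric, hence summable, bound on first moments over the probability space of the cube.
\<close>

lemma nn_integral_norm_cube_le: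
  assumes [measurable]: "f \<in> borel_measurable borel" and K: "0 \<le> K"
    and le: "(\<integral>\<^sup>+ z. ennreal ((norm (f z :: 'b::euclidean_space))\<^sup>2) \<partial>cube_measure) \<le> ennreal (K * (1 / 16) ^ n)"
  shows "(\<integral>\<^sup>+ z. ennreal (norm (f z)) \<partial>cube_measure) \<le> ennreal ((K + 1) * (1 / 4) ^ n)"
proof -
  have "(\<integral>\<^sup>+ z. ennreal (norm (f z)) \<partial>cube_measure) \<le>
      (\<integral>\<^sup>+ z. ennreal (4 ^ n) * ennreal ((norm (f z))\<^sup>2) + ennreal ((1 / 4) ^ n) \<partial>cube_measure)"
  proof (rule nn_integral_mono)
    fix z
    have "(2 ^ n * norm (f z)) * (1 / 2) ^ n \<le> (2 ^ n * norm (f z))\<^sup>2 + ((1 / 2) ^ n)\<^sup>2"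
      using zero_le_power2[of "2 ^ n * norm (f z) - (1 / 2) ^ n"]
        zero_le_power2[of "2 ^ n * norm (f z)"] zero_le_power2[of "(1 / 2 :: real) ^ n"]
      unfolding power2_diff by linarith
    also have "(2 ^ n * norm (f z)) * (1 / 2) ^ n = norm (f z)"
      by (simp add: power_one_over)
    also have "(2 ^ n * norm (f z))\<^sup>2 + ((1 / 2) ^ n)\<^sup>2 = 4 ^ n * (norm (f z))\<^sup>2 + (1 / 4) ^ n"
      by (simp add: power_mult_distrib power_mult[symmetric] mult.commute[of n])
         (simp add: power_mult power2_eq_square)
    finally show "ennreal (norm (f z)) \<le> ennreal (4 ^ n) * ennreal ((norm (f z))\<^sup>2) + ennreal ((1 / 4) ^ n)"
      by (simp add: ennreal_leI ennreal_plus[symmetric] ennreal_mult[symmetric] del: ennreal_plus)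
  qed
  also have "\<dots> = ennreal (4 ^ n) * (\<integral>\<^sup>+ z. ennreal ((norm (f z))\<^sup>2) \<partial>cube_measure) + ennreal ((1 / 4) ^ n)"
    using cube.emeasure_space_1 by (simp add: nn_integral_add nn_integral_cmult)
  also have "\<dots> \<le> ennreal (4 ^ n) * ennreal (K * (1 / 16) ^ n) + ennreal ((1 / 4) ^ n)"
    by (intro add_mono mult_left_mono le) auto
  also have "\<dots> = ennreal (4 ^ n * (K * (1 / 16) ^ n) + (1 / 4) ^ n)"
    using K by (simp add: ennreal_mult)
  also have "4 ^ n * (K * (1 / 16) ^ n) = K * (1 / 4 :: real) ^ n"
    by (simp add: power_mult_distrib[symmetric] mult.left_commute)
  finally show ?thesis by (simp add: algebra_simps)
qed

lemma convergent_if_summable_differences: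
  fixes x :: "nat \<Rightarrow> 'a::banach"
  assumes "summable (\<lambda>n. norm (x (Suc n) - x n))"
  shows "convergent x"
proof -
  have "summable (\<lambda>n. x (Suc n) - x n)"
    by (rule summable_norm_cancel[OF assms])
  then have "convergent (\<lambda>n. \<Sum>k<n. x (Suc k) - x k)"
    by (simp add: summable_iff_convergent)
  then have "convergent (\<lambda>n. (x n - x 0) + x 0)"
    by (intro convergent_add convergent_const) (simp add: sum_lessThan_telescope)
  then show ?thesis by simp
qed

text \<open>
  Completeness, in the form that the direct method needs. The rate is geometric, so the norms of
  successive differences have a summable integral, and almost every orbit \<open>u\<^sub>n(z)\<close> in the cube is
  Cauchy; periodicity spreads this over the whole space. Fatou's lemma, applied to \<open>u\<^sub>k - u\<^sub>n\<close>
  as \<open>k\<close> grows, shows that the limit is close to \<open>u\<^sub>n\<close> in mean square, and thus that it is square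
  integrable and inherits mean zero.
\<close>

lemma L2_per0_complete:
  fixes u :: "nat \<Rightarrow> real^3 \<Rightarrow> real^3"
  assumes u: "\<And>n. u n \<in> L2_per0 UNIV" and K: "0 \<le> K"
    and cauchy: "\<And>n k. n \<le> k \<Longrightarrow>
      (\<integral>\<^sup>+ z. ennreal ((norm (u k z - u n z))\<^sup>2) \<partial>cube_measure) \<le> ennreal (K * (1 / 16) ^ n)"
  shows "\<exists>v\<in>L2_per0 UNIV. AE z in lborel. (\<lambda>n. u n z) \<longlonglongrightarrow> v z"
proof -
  have meas[measurable]: "u n \<in> borel_measurable borel" for n
    using u by (simp add: L2_per0_iff)
  have per: "Q_periodic (u n)" for n
    using u by (simp add: L2_per0_iff)
  let ?L = "\<lambda>n. (\<integral>\<^sup>+ z. ennreal (norm (u (Suc n) z - u n z)) \<partial>cube_measure)"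
  have "(\<integral>\<^sup>+ z. (\<Sum>n. ennreal (norm (u (Suc n) z - u n z))) \<partial>cube_measure) = (\<Sum>n. ?L n)"
    by (intro nn_integral_suminf) measurable
  also have "\<dots> \<le> (\<Sum>n. ennreal ((K + 1) * (1 / 4) ^ n))"
    using cauchy by (intro suminf_le summableI nn_integral_norm_cube_le K) auto
  also have "\<dots> = ennreal (\<Sum>n. (K + 1) * (1 / 4) ^ n)"
    using K by (intro suminf_ennreal2 summable_mult summable_geometric) auto
  also have "\<dots> < \<infinity>" by simp
  finally have "AE z in cube_measure. (\<Sum>n. ennreal (norm (u (Suc n) z - u n z))) \<noteq> \<infinity>"
    by (intro nn_integral_noteq_infinite) auto
  then have "AE z in cube_measure. Cauchy (\<lambda>n. u n z)"
  proof eventually_elim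
    case (elim z)
    have "summable (\<lambda>n. norm (u (Suc n) z - u n z))"
      using elim by (intro summable_suminf_not_top) auto
    then show ?case
      by (intro convergent_Cauchy convergent_if_summable_differences)
  qed
  then have on_cube: "AE z in lborel. z \<in> unit_cube \<longrightarrow> Cauchy (\<lambda>n. u n z)"
    by (simp add: AE_cube_iff)
  have per_all: "AE z in lborel. \<forall>n. u n (z + axis i 1) = u n z" for i
    using per by (simp add: AE_all_countable Q_periodic_def ae_period_def)
  have per_cauchy: "Q_periodic (\<lambda>z. Cauchy (\<lambda>n. u n z))"
    unfolding Q_periodic_def ae_period_def
  proof
    fix i
    from per_all[of i] show "AE z in lborel. Cauchy (\<lambda>n. u n (z + axis i 1)) = Cauchy (\<lambda>n. u n z)"
      by eventually_elim simp
  qed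
  have "AE z in lborel. Cauchy (\<lambda>n. u n z)"
    by (rule AE_periodic_from_cube[OF per_cauchy _ on_cube]) measurable
  \<comment> \<open>Where the sequence diverges the value of \<open>lim\<close> is arbitrary; this happens on a null set only.\<close>
  moreover define v where "v z = lim (\<lambda>n. u n z)" for z
  ultimately have lim: "AE z in lborel. (\<lambda>n. u n z) \<longlonglongrightarrow> v z"
    by (auto simp: v_def Cauchy_convergent_iff convergent_LIMSEQ_iff elim!: eventually_mono)
  have [measurable]: "v \<in> borel_measurable borel"
    unfolding v_def by measurable
  have "Q_periodic v"
    unfolding Q_periodic_def ae_period_def
  proof
    fix i
    from per_all[of i] show "AE z in lborel. v (z + axis i 1) = v z"
      by eventually_elim (simp add: v_def)
  qed
  have close: "(\<integral>\<^sup>+ z. ennreal ((norm (v z - u n z))\<^sup>2) \<partial>cube_measure) \<le> ennreal (K * (1 / 16) ^ n)" for n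
  proof (rule nn_integral_le_of_AE_limit)
    show "AE z in cube_measure. (\<lambda>k. ennreal ((norm (u k z - u n z))\<^sup>2)) \<longlonglongrightarrow> ennreal ((norm (v z - u n z))\<^sup>2)"
      using AE_cube[OF lim] by eventually_elim (intro tendsto_intros tendsto_ennrealI)
    show "\<forall>\<^sub>F k in sequentially. (\<integral>\<^sup>+ z. ennreal ((norm (u k z - u n z))\<^sup>2) \<partial>cube_measure) \<le> ennreal (K * (1 / 16) ^ n)"
      using eventually_ge_at_top[of n] by eventually_elim (rule cauchy)
    show "(\<lambda>z. ennreal ((norm (u k z - u n z))\<^sup>2)) \<in> borel_measurable cube_measure" for k
      by measurable
  qed simp
  have sq_diff: "sq_integrable cube_measure (\<lambda>z. v z - u n z)" for n
    using close[of n] by (subst sq_integrable_iff_nn_integral) (auto simp: le_less_trans)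
  have sq: "sq_integrable cube_measure v"
    using sq_integrable_add[OF sq_diff[of 0], of "u 0"] u[of 0] by (simp add: L2_per0_iff)
  have int: "integrable cube_measure v"
    by (intro sq_integrable_imp_integrable sq cube.finite_measure_axioms)
  have "norm (integral\<^sup>L cube_measure v) \<le> (K + 1) * (1 / 4) ^ n" for n
  proof -
    have "integral\<^sup>L cube_measure v = (LINT z|cube_measure. v z - u n z)"
      using int integrable_cube_L2_per0[OF u[of n]] u[of n] by (simp add: L2_per0_iff)
    then have "ennreal (norm (integral\<^sup>L cube_measure v)) \<le> (\<integral>\<^sup>+ z. ennreal (norm (v z - u n z)) \<partial>cube_measure)"
      using integral_norm_bound_ennreal[of cube_measure "\<lambda>z. v z - u n z"] int integrable_cube_L2_per0[OF u[of n]]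
      by simp
    also have "\<dots> \<le> ennreal ((K + 1) * (1 / 4) ^ n)"
      by (intro nn_integral_norm_cube_le K close) measurable
    finally show ?thesis
      using K by (subst (asm) ennreal_le_iff) auto
  qed
  moreover have "(\<lambda>n. (K + 1) * (1 / 4) ^ n) \<longlonglongrightarrow> (K + 1) * 0"
    by (intro tendsto_intros LIMSEQ_power_zero) simp
  ultimately have "norm (integral\<^sup>L cube_measure v) \<le> (K + 1) * 0"
    by (intro LIMSEQ_le_const[where x = "(K + 1) * 0"]) auto
  then have "v \<in> L2_per0 UNIV"
    using sq \<open>Q_periodic v\<close> by (simp add: L2_per0_iff)
  with lim show ?thesis by blast
qed

section \<open>The quadratic variational problem\<close>

context nonlocal_weight
begin

text \<open>
  The squared distance, in the weighted space \<open>L\<^sup>2\<close>, from \<open>- g\<close> to the difference quotient of \<open>v\<close>.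
  It is an extended value because not every \<open>v\<close> in \<open>L2_per0 V\<close> has a square integrable difference
  quotient.
\<close>

definition energy :: "((real^3) \<times> (real^3) \<Rightarrow> real^3) \<Rightarrow> (real^3 \<Rightarrow> real^3) \<Rightarrow> ennreal" where
  "energy g v = (\<integral>\<^sup>+ p. ennreal ((norm (g p + diff_quot v p))\<^sup>2) \<partial>weighted)"

definition finite_dirichlet :: "(real^3) set \<Rightarrow> (real^3 \<Rightarrow> real^3) set" where
  "finite_dirichlet V = {v \<in> L2_per0 V. sq_integrable weighted (diff_quot v)}"

text \<open>
  The Euler-Lagrange equation of \<open>energy g\<close>. Test functions have finite Dirichlet energy, so that
  the inner product below is integrable.
\<close>

definition critical :: "(real^3) set \<Rightarrow> ((real^3) \<times> (real^3) \<Rightarrow> real^3) \<Rightarrow> (real^3 \<Rightarrow> real^3) \<Rightarrow> bool" where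
  "critical V g v \<longleftrightarrow> v \<in> finite_dirichlet V \<and>
     (\<forall>w\<in>finite_dirichlet V. (LINT p|weighted. (g p + diff_quot v p) \<bullet> diff_quot w p) = 0)"

lemma diff_quot_weighted_measurable: "v \<in> L2_per0 V \<Longrightarrow> diff_quot v \<in> borel_measurable weighted"
  using diff_quot_measurable[of v] measurable_cong_sets[OF sets_weighted refl] by (auto simp: L2_per0_iff)

lemma energy_eq:
  assumes "sq_integrable weighted g" "v \<in> finite_dirichlet V"
  shows "energy g v = ennreal (LINT p|weighted. (norm (g p + diff_quot v p))\<^sup>2)"
  using assms unfolding energy_def finite_dirichlet_def
  by (intro nn_integral_sq_norm sq_integrable_add) auto

lemma finite_energy_imp_finite_dirichlet:
  assumes g: "sq_integrable weighted g" and v: "v \<in> L2_per0 V" and fin: "energy g v < \<infinity>"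
  shows "v \<in> finite_dirichlet V"
proof -
  have [measurable]: "g \<in> borel_measurable weighted" "diff_quot v \<in> borel_measurable weighted"
    using g diff_quot_weighted_measurable[OF v] by (auto simp: sq_integrable_def)
  have "sq_integrable weighted (\<lambda>p. g p + diff_quot v p)"
    using fin unfolding energy_def by (subst sq_integrable_iff_nn_integral) auto
  from sq_integrable_diff[OF this g] show ?thesis
    using v by (simp add: finite_dirichlet_def)
qed

lemma zero_finite_dirichlet: "subspace V \<Longrightarrow> (\<lambda>z. 0) \<in> finite_dirichlet V"
  by (simp add: finite_dirichlet_def zero_L2_per0 diff_quot_zero[abs_def] sq_integrable_zero)

lemma add_finite_dirichlet:
  "subspace V \<Longrightarrow> v \<in> finite_dirichlet V \<Longrightarrow> w \<in> finite_dirichlet V \<Longrightarrow> (\<lambda>z. v z + w z) \<in> finite_dirichlet V"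
  by (simp add: finite_dirichlet_def add_L2_per0 diff_quot_add[abs_def] sq_integrable_add)

lemma diff_finite_dirichlet:
  "subspace V \<Longrightarrow> v \<in> finite_dirichlet V \<Longrightarrow> w \<in> finite_dirichlet V \<Longrightarrow> (\<lambda>z. v z - w z) \<in> finite_dirichlet V"
  by (simp add: finite_dirichlet_def diff_L2_per0 diff_quot_diff[abs_def] sq_integrable_diff)

lemma linear_image_finite_dirichlet:
  assumes "v \<in> finite_dirichlet V" "linear L" "\<And>x. x \<in> V \<Longrightarrow> L x \<in> W"
  shows "(\<lambda>z. L (v z)) \<in> finite_dirichlet W"
  using assms linear_image_L2_per0[of v V L W] sq_integrable_bounded_linear[of weighted "diff_quot v" L]
  by (simp add: finite_dirichlet_def diff_quot_linear[OF assms(2), abs_def] linear_conv_bounded_linear)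

lemma scaleR_finite_dirichlet:
  "subspace V \<Longrightarrow> v \<in> finite_dirichlet V \<Longrightarrow> (\<lambda>z. t *\<^sub>R v z) \<in> finite_dirichlet V"
  by (erule linear_image_finite_dirichlet) (auto simp: subspace_scale linear_iff scaleR_add_right)

text \<open>
  Comparison with 0 shows that a minimizer has finite energy; then all variations by admissible
  test functions have finite energy as well, and the first variation vanishes.
\<close>

lemma minimizer_critical:
  assumes V: "subspace V" and g: "sq_integrable weighted g"
    and min: "is_arg_min (energy g) (\<lambda>u. u \<in> L2_per0 V) v"
  shows "critical V g v"
proof -
  have v: "v \<in> L2_per0 V" and le: "\<And>w. w \<in> L2_per0 V \<Longrightarrow> energy g v \<le> energy g w"
    using min by (auto simp: is_arg_min_linorder)
  have "energy g v \<le> energy g (\<lambda>z. 0)"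
    by (intro le zero_L2_per0 V)
  also have "\<dots> < \<infinity>"
    by (simp add: energy_eq[OF g zero_finite_dirichlet[OF V]])
  finally have fv: "v \<in> finite_dirichlet V"
    by (rule finite_energy_imp_finite_dirichlet[OF g v])
  have "(LINT p|weighted. (g p + diff_quot v p) \<bullet> diff_quot w p) = 0" if w: "w \<in> finite_dirichlet V" for w
  proof (rule orthogonal_if_minimal)
    show "sq_integrable weighted (\<lambda>p. g p + diff_quot v p)" "sq_integrable weighted (diff_quot w)"
      using g fv w by (auto simp: finite_dirichlet_def intro: sq_integrable_add)
    fix t
    have vw: "(\<lambda>z. v z + t *\<^sub>R w z) \<in> finite_dirichlet V"
      by (intro add_finite_dirichlet scaleR_finite_dirichlet V fv w)
    then have "energy g v \<le> energy g (\<lambda>z. v z + t *\<^sub>R w z)"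
      by (intro le) (simp add: finite_dirichlet_def)
    then show "(LINT p|weighted. (norm (g p + diff_quot v p))\<^sup>2) \<le>
        (LINT p|weighted. (norm (g p + diff_quot v p + t *\<^sub>R diff_quot w p))\<^sup>2)"
      unfolding energy_eq[OF g fv] energy_eq[OF g vw]
      by (simp add: diff_quot_add diff_quot_scaleR add.assoc)
  qed
  with fv show ?thesis by (simp add: critical_def)
qed

text \<open>
  The cross term vanishes by the Euler-Lagrange equation. Convexity of the problem is contained in
  this identity: it gives minimality, uniqueness and the value of the minimum.
\<close>

lemma critical_pythagoras:
  assumes g: "sq_integrable weighted g" and crit: "critical V g v" and w: "w \<in> finite_dirichlet V"
  shows "(LINT p|weighted. (norm (g p + diff_quot v p + t *\<^sub>R diff_quot w p))\<^sup>2) =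
    (LINT p|weighted. (norm (g p + diff_quot v p))\<^sup>2) + t\<^sup>2 * (LINT p|weighted. (norm (diff_quot w p))\<^sup>2)"
  using crit w integral_sq_norm_add[OF sq_integrable_add[OF g, of "diff_quot v"], of "diff_quot w" t]
  by (auto simp: critical_def finite_dirichlet_def)

text \<open>
  The case in which the solution itself is subtracted, \<open>w = v\<close> and \<open>t = -1\<close>.
\<close>

lemma critical_energy:
  assumes g: "sq_integrable weighted g" and crit: "critical V g v"
  shows "(LINT p|weighted. (norm (g p + diff_quot v p))\<^sup>2) =
    (LINT p|weighted. (norm (g p))\<^sup>2) - (LINT p|weighted. (norm (diff_quot v p))\<^sup>2)"
  using critical_pythagoras[OF g crit, of v "-1"] crit by (simp add: critical_def)

lemma critical_minimizer:
  assumes V: "subspace V" and g: "sq_integrable weighted g" and crit: "critical V g v"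
  shows "is_arg_min (energy g) (\<lambda>u. u \<in> L2_per0 V) v"
proof -
  have v: "v \<in> finite_dirichlet V" using crit by (simp add: critical_def)
  have "energy g v \<le> energy g w" if w: "w \<in> L2_per0 V" for w
  proof (cases "energy g w < \<infinity>")
    case True
    then have fw: "w \<in> finite_dirichlet V"
      by (rule finite_energy_imp_finite_dirichlet[OF g w])
    have "0 \<le> (LINT p|weighted. (norm (diff_quot (\<lambda>z. w z - v z) p))\<^sup>2)"
      by simp
    then show ?thesis
      using critical_pythagoras[OF g crit diff_finite_dirichlet[OF V fw v], of 1]
      by (simp add: energy_eq[OF g v] energy_eq[OF g fw] diff_quot_diff ennreal_leI)
  qed (simp add: not_less top_unique)
  then show ?thesis
    using v by (simp add: is_arg_min_linorder finite_dirichlet_def)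
qed

text \<open>
  Each of two solutions exceeds the other in energy by the Dirichlet energy of their difference,
  which therefore is zero; the Poincare inequality then makes the difference vanish.
\<close>

lemma critical_unique:
  assumes V: "subspace V" and g: "sq_integrable weighted g"
    and v: "critical V g v" and w: "critical V g w"
  shows "AE z in lborel. w z = v z"
proof -
  let ?u = "\<lambda>z. w z - v z"
  have fv: "v \<in> finite_dirichlet V" and fw: "w \<in> finite_dirichlet V"
    using v w by (auto simp: critical_def)
  have u: "?u \<in> finite_dirichlet V"
    by (intro diff_finite_dirichlet V fv fw)
  then have uL: "?u \<in> L2_per0 V" by (simp add: finite_dirichlet_def)
  have "(LINT p|weighted. (norm (g p + diff_quot w p))\<^sup>2) =
      (LINT p|weighted. (norm (g p + diff_quot v p))\<^sup>2) + (LINT p|weighted. (norm (diff_quot ?u p))\<^sup>2)"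
    "(LINT p|weighted. (norm (g p + diff_quot v p))\<^sup>2) =
      (LINT p|weighted. (norm (g p + diff_quot w p))\<^sup>2) + (LINT p|weighted. (norm (diff_quot ?u p))\<^sup>2)"
    using critical_pythagoras[OF g v u, of 1] critical_pythagoras[OF g w u, of "-1"]
    by (simp_all add: diff_quot_diff)
  then have "(LINT p|weighted. (norm (diff_quot ?u p))\<^sup>2) = 0" by linarith
  then have D: "(\<integral>\<^sup>+ p. ennreal ((norm (diff_quot ?u p))\<^sup>2) \<partial>weighted) = 0"
    using u by (simp add: nn_integral_sq_norm finite_dirichlet_def)
  obtain K :: real where K: "\<forall>V. \<forall>v\<in>L2_per0 V. (\<integral>\<^sup>+ z. ennreal ((norm (v z))\<^sup>2) \<partial>cube_measure) \<le>
     ennreal K * (\<integral>\<^sup>+ p. ennreal ((norm (diff_quot v p))\<^sup>2) \<partial>weighted)"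
    using poincare by (rule exE)
  from K[rule_format, OF uL] have "(\<integral>\<^sup>+ z. ennreal ((norm (?u z))\<^sup>2) \<partial>cube_measure) = 0"
    using D by simp
  moreover have [measurable]: "v \<in> borel_measurable borel" "w \<in> borel_measurable borel"
    using fv fw by (auto simp: finite_dirichlet_def L2_per0_iff)
  ultimately have "AE z in cube_measure. w z = v z"
    by (subst (asm) nn_integral_0_iff_AE) auto
  then have on_cube: "AE z in lborel. z \<in> unit_cube \<longrightarrow> w z = v z"
    by (simp add: AE_cube_iff)
  have "Q_periodic (\<lambda>z. w z = v z)"
    using fv fw by (intro Q_periodic_comp2[of w v "(=)"]) (auto simp: finite_dirichlet_def L2_per0_iff)
  then show ?thesis
    by (rule AE_periodic_from_cube[OF _ _ on_cube]) measurable
qed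

lemma parallelogram:
  assumes g: "sq_integrable weighted g" and u: "u \<in> finite_dirichlet UNIV" and w: "w \<in> finite_dirichlet UNIV"
  shows "(LINT p|weighted. (norm (diff_quot (\<lambda>z. w z - u z) p))\<^sup>2) =
    2 * (LINT p|weighted. (norm (g p + diff_quot u p))\<^sup>2) + 2 * (LINT p|weighted. (norm (g p + diff_quot w p))\<^sup>2)
    - 4 * (LINT p|weighted. (norm (g p + diff_quot (\<lambda>z. (1 / 2) *\<^sub>R (u z + w z)) p))\<^sup>2)"
proof -
  let ?h = "\<lambda>z. (1 / 2) *\<^sub>R (u z + w z)"
  have h: "?h \<in> finite_dirichlet UNIV"
    by (intro scaleR_finite_dirichlet add_finite_dirichlet u w) auto
  have pt: "(norm (diff_quot (\<lambda>z. w z - u z) p))\<^sup>2 = 2 * (norm (g p + diff_quot u p))\<^sup>2 +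
      2 * (norm (g p + diff_quot w p))\<^sup>2 - 4 * (norm (g p + diff_quot ?h p))\<^sup>2" for p
    unfolding diff_quot_diff diff_quot_scaleR diff_quot_add power2_norm_eq_inner
    by (simp add: inner_add_left inner_add_right inner_diff_left inner_diff_right inner_commute field_simps)
  have "integrable weighted (\<lambda>p. (norm (g p + diff_quot f p))\<^sup>2)" if "f \<in> finite_dirichlet UNIV" for f
    using sq_integrable_add[OF g, of "diff_quot f"] that by (auto simp: finite_dirichlet_def sq_integrable_def)
  then show ?thesis
    unfolding pt using u w h by simp
qed

text \<open>
  The direct method. By the parallelogram identity a minimizing sequence is Cauchy in Dirichlet
  energy, by the Poincare inequality it is Cauchy in mean square, and Fatou's lemma bounds the energy
  of its almost everywhere limit by the infimum.
\<close>

lemma minimizer_exists: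
  assumes g: "sq_integrable weighted g"
  shows "\<exists>v. is_arg_min (energy g) (\<lambda>u. u \<in> L2_per0 UNIV) v"
proof -
  let ?S = "finite_dirichlet UNIV"
  define J where "J u = (LINT p|weighted. (norm (g p + diff_quot u p))\<^sup>2)" for u
  define I where "I = (INF u\<in>?S. J u)"
  have ne: "?S \<noteq> {}" using zero_finite_dirichlet[of UNIV] by auto
  have J0: "0 \<le> J u" for u by (simp add: J_def)
  have bdd: "bdd_below (J ` ?S)" using J0 by (auto intro!: bdd_belowI[of _ 0])
  have I_le: "I \<le> J u" if "u \<in> ?S" for u
    unfolding I_def using bdd that by (rule cINF_lower)
  have I0: "0 \<le> I" unfolding I_def using ne J0 by (intro cINF_greatest) auto
  \<comment> \<open>The excess \<open>16\<^sup>-\<^sup>n\<close> yields the geometric rate required for completeness.\<close>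
  have "\<exists>u\<in>?S. J u < I + (1 / 16) ^ n" for n
    using cINF_less_iff[OF ne bdd, of "I + (1 / 16) ^ n"] by (simp add: I_def)
  then obtain u where u: "\<And>n. u n \<in> ?S" and J_u: "\<And>n. J (u n) < I + (1 / 16) ^ n"
    by metis
  have uL: "u n \<in> L2_per0 UNIV" for n using u by (simp add: finite_dirichlet_def)
  then have [measurable]: "u n \<in> borel_measurable borel" for n by (simp add: L2_per0_iff)
  obtain K :: real where "\<forall>V. \<forall>v\<in>L2_per0 V. (\<integral>\<^sup>+ z. ennreal ((norm (v z))\<^sup>2) \<partial>cube_measure) \<le>
     ennreal K * (\<integral>\<^sup>+ p. ennreal ((norm (diff_quot v p))\<^sup>2) \<partial>weighted)"
    using poincare by (rule exE)
  note K = this[rule_format]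
  have "(\<integral>\<^sup>+ z. ennreal ((norm (u k z - u n z))\<^sup>2) \<partial>cube_measure) \<le> ennreal (\<bar>K\<bar> * 4 * (1 / 16) ^ n)"
    if "n \<le> k" for n k
  proof -
    let ?d = "\<lambda>z. u k z - u n z" and ?h = "\<lambda>z. (1 / 2) *\<^sub>R (u n z + u k z)"
    have d: "?d \<in> ?S" and h: "?h \<in> ?S"
      by (auto intro!: diff_finite_dirichlet scaleR_finite_dirichlet add_finite_dirichlet u)
    have "(LINT p|weighted. (norm (diff_quot ?d p))\<^sup>2) = 2 * J (u n) + 2 * J (u k) - 4 * J ?h"
      unfolding J_def by (rule parallelogram[OF g u u])
    also have "\<dots> \<le> 4 * (1 / 16) ^ n"
    proof -
      have "(1 / 16 :: real) ^ k \<le> (1 / 16) ^ n"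
        using that by (intro power_decreasing) auto
      then show ?thesis
        using J_u[of n] J_u[of k] I_le[OF h] by linarith
    qed
    finally have le: "(LINT p|weighted. (norm (diff_quot ?d p))\<^sup>2) \<le> 4 * (1 / 16) ^ n" .
    have "(\<integral>\<^sup>+ z. ennreal ((norm (?d z))\<^sup>2) \<partial>cube_measure) \<le>
        ennreal K * (\<integral>\<^sup>+ p. ennreal ((norm (diff_quot ?d p))\<^sup>2) \<partial>weighted)"
      using d by (intro K[of _ UNIV]) (simp add: finite_dirichlet_def)
    also have "\<dots> = ennreal K * ennreal (LINT p|weighted. (norm (diff_quot ?d p))\<^sup>2)"
      using d by (simp add: nn_integral_sq_norm finite_dirichlet_def)
    also have "\<dots> \<le> ennreal \<bar>K\<bar> * ennreal (4 * (1 / 16) ^ n)"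
      by (intro mult_mono ennreal_leI le) auto
    also have "\<dots> = ennreal (\<bar>K\<bar> * 4 * (1 / 16) ^ n)"
      by (simp add: ennreal_mult[symmetric] mult.assoc)
    finally show ?thesis .
  qed
  then obtain v where v: "v \<in> L2_per0 UNIV" and lim: "AE z in lborel. (\<lambda>n. u n z) \<longlonglongrightarrow> v z"
    using L2_per0_complete[where u = u and K = "\<bar>K\<bar> * 4", OF uL] by auto
  have [measurable]: "g \<in> borel_measurable weighted"
    using g by (simp add: sq_integrable_def)
  have "energy g v \<le> ennreal I"
    unfolding energy_def
  proof (rule nn_integral_le_of_AE_limit)
    show "(\<lambda>p. ennreal ((norm (g p + diff_quot (u n) p))\<^sup>2)) \<in> borel_measurable weighted" for n
      using diff_quot_weighted_measurable[OF uL] by measurable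
    have "AE p in cell_measure. (\<lambda>n. ennreal ((norm (g p + diff_quot (u n) p))\<^sup>2)) \<longlonglongrightarrow>
        ennreal ((norm (g p + diff_quot v p))\<^sup>2)"
      using AE_cell_endpoints[OF lim] unfolding diff_quot_def
      by eventually_elim (intro tendsto_intros tendsto_ennrealI)
    then show "AE p in weighted. (\<lambda>n. ennreal ((norm (g p + diff_quot (u n) p))\<^sup>2)) \<longlonglongrightarrow>
        ennreal ((norm (g p + diff_quot v p))\<^sup>2)"
      by (rule AE_weighted)
    have "(\<integral>\<^sup>+ p. ennreal ((norm (g p + diff_quot (u n) p))\<^sup>2) \<partial>weighted) \<le> ennreal (I + (1 / 16) ^ n)" for n
      using energy_eq[OF g u[of n]] J_u[of n] unfolding energy_def J_def by (simp add: ennreal_leI)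
    then show "\<forall>\<^sub>F n in sequentially. (\<integral>\<^sup>+ p. ennreal ((norm (g p + diff_quot (u n) p))\<^sup>2) \<partial>weighted) \<le>
        ennreal (I + (1 / 16) ^ n)" by simp
    have "(\<lambda>n. I + (1 / 16) ^ n) \<longlonglongrightarrow> I + 0"
      by (intro tendsto_intros LIMSEQ_power_zero) simp
    then show "(\<lambda>n. ennreal (I + (1 / 16) ^ n)) \<longlonglongrightarrow> ennreal I"
      by (intro tendsto_ennrealI) simp
  qed
  moreover have "ennreal I \<le> energy g w" if w: "w \<in> L2_per0 UNIV" for w
  proof (cases "energy g w < \<infinity>")
    case True
    then have "w \<in> ?S" by (rule finite_energy_imp_finite_dirichlet[OF g w])
    then show ?thesis
      using I_le by (simp add: energy_eq[OF g] J_def ennreal_leI)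
  qed (simp add: not_less top_unique)
  ultimately show ?thesis
    using v by (auto simp: is_arg_min_linorder intro!: exI[of _ v] intro: order_trans)
qed

lemma critical_add:
  assumes V: "subspace V" and g: "sq_integrable weighted g" "critical V g v"
    and h: "sq_integrable weighted h" "critical V h w"
  shows "critical V (\<lambda>p. g p + h p) (\<lambda>z. v z + w z)"
  unfolding critical_def
proof (intro conjI ballI)
  have fv: "v \<in> finite_dirichlet V" and fw: "w \<in> finite_dirichlet V"
    using g h by (auto simp: critical_def)
  then show "(\<lambda>z. v z + w z) \<in> finite_dirichlet V"
    by (rule add_finite_dirichlet[OF V])
  fix f assume f: "f \<in> finite_dirichlet V"
  have "integrable weighted (\<lambda>p. (g p + diff_quot v p) \<bullet> diff_quot f p)"
    "integrable weighted (\<lambda>p. (h p + diff_quot w p) \<bullet> diff_quot f p)"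
    using g h fv fw f by (auto intro!: sq_integrable_inner sq_integrable_add simp: finite_dirichlet_def)
  moreover have "(LINT p|weighted. (g p + diff_quot v p) \<bullet> diff_quot f p) = 0"
    "(LINT p|weighted. (h p + diff_quot w p) \<bullet> diff_quot f p) = 0"
    using g h f by (auto simp: critical_def)
  moreover have "(g p + h p + diff_quot (\<lambda>z. v z + w z) p) \<bullet> diff_quot f p =
      (g p + diff_quot v p) \<bullet> diff_quot f p + (h p + diff_quot w p) \<bullet> diff_quot f p" for p
    by (simp add: diff_quot_add inner_add_left)
  ultimately show "(LINT p|weighted. (g p + h p + diff_quot (\<lambda>z. v z + w z) p) \<bullet> diff_quot f p) = 0"
    by simp
qed

text \<open>
  The map \<open>L\<close> acts on values only and commutes with difference quotients, so it can be moved onto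
  the test function as its adjoint. Orthogonality to all test functions with values in \<open>V\<close> follows
  from orthogonality to all test functions without any constraint.
\<close>

lemma critical_linear:
  assumes crit: "critical UNIV g v" and L: "linear L" "range L \<subseteq> V"
  shows "critical V (\<lambda>p. L (g p)) (\<lambda>z. L (v z))"
  unfolding critical_def
proof (intro conjI ballI)
  show "(\<lambda>z. L (v z)) \<in> finite_dirichlet V"
  proof (rule linear_image_finite_dirichlet[OF _ L(1)])
    show "v \<in> finite_dirichlet UNIV" using crit by (simp add: critical_def)
  qed (use L(2) in auto)
  fix w assume w: "w \<in> finite_dirichlet V"
  have adj: "linear (adjoint L)" by (rule adjoint_linear[OF L(1)])
  have "(\<lambda>z. adjoint L (w z)) \<in> finite_dirichlet UNIV"
    by (rule linear_image_finite_dirichlet[OF w adj]) auto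
  then have "(LINT p|weighted. (g p + diff_quot v p) \<bullet> diff_quot (\<lambda>z. adjoint L (w z)) p) = 0"
    using crit by (simp add: critical_def)
  moreover have "(L (g p) + diff_quot (\<lambda>z. L (v z)) p) \<bullet> diff_quot w p =
      (g p + diff_quot v p) \<bullet> diff_quot (\<lambda>z. adjoint L (w z)) p" for p
    by (simp add: diff_quot_linear[OF L(1)] diff_quot_linear[OF adj] linear_add[OF L(1), symmetric]
        adjoint_works[OF L(1)])
  ultimately show "(LINT p|weighted. (L (g p) + diff_quot (\<lambda>z. L (v z)) p) \<bullet> diff_quot w p) = 0"
    by simp
qed

end

section \<open>Tensors, cross products and tangent spaces\<close>

lemma tensor_axis: "tensor u w = (\<Sum>i\<in>UNIV. \<Sum>j\<in>UNIV. (u $ i * w $ j) *\<^sub>R axis i (axis j 1))"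
  by (simp add: tensor_def vec_eq_iff axis_def sum_3 forall_3)

lemma tensor_measurable[measurable]:
  assumes [measurable]: "f \<in> borel_measurable M" "g \<in> borel_measurable M"
  shows "(\<lambda>x. tensor (f x) (g x)) \<in> borel_measurable M"
  unfolding tensor_axis
  by (intro borel_measurable_sum borel_measurable_scaleR borel_measurable_times borel_measurable_const
      measurable_compose[OF _ borel_measurable_nth] assms)

lemma norm_tensor: "norm (tensor u w) = norm u * norm w"
  by (simp add: norm_eq_sqrt_inner tensor_def inner_vec_def sum_3 real_sqrt_mult[symmetric] algebra_simps)

lemma matrix_mul_tensor_inner: "(A ** tensor u w) \<bullet> (A :: real^3^3) = (A *v u) \<bullet> (A *v w)"
  by (simp add: tensor_def matrix_matrix_mult_def matrix_vector_mult_def inner_vec_def sum_3 algebra_simps)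

lemma linear_matrix_mul_inner: "linear (\<lambda>T. ((A :: real^3^3) ** T) \<bullet> (B :: real^3^3))"
  by (rule linearI)
     (simp_all add: matrix_matrix_mult_def inner_vec_def sum_3 algebra_simps)

lemma linear_dot_cross3: "linear (\<lambda>d. s \<bullet> cross3 d w)"
  by (rule linearI) (simp_all add: cross_add_left cross_mult_left inner_add_right)

lemma linear_cross3: "linear (cross3 s)"
  by (rule linearI) (simp_all add: cross_add_right cross_mult_right)

lemma dot_cross3_cyclic: "s \<bullet> cross3 d w = w \<bullet> cross3 s d"
  by (simp add: cross3_simps)

text \<open>
  Since \<open>A *v x\<close> combines the columns of \<open>A\<close> with the coordinates of \<open>x\<close>, the three coordinatewise
  integrals \<open>d_bar\<close> recombine into a single one.
\<close>

lemma sum_dot_cross3_columns: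
  fixes A :: "real^3^3"
  shows "(\<Sum>i\<in>UNIV. s \<bullet> cross3 ((k * x $ i) *\<^sub>R d) (A *v axis i 1)) = k * ((A *v x) \<bullet> cross3 s d)"
proof -
  have "A *v x = (\<Sum>i\<in>UNIV. x $ i *\<^sub>R (A *v axis i 1))"
    by (simp add: matrix_mult_sum[of A x] matrix_vector_mult_basis scalar_mult_eq_scaleR)
  then show ?thesis
    by (simp only: inner_sum_left dot_cross3_cyclic[of s] cross_mult_right inner_scaleR_left
        inner_scaleR_right sum_distrib_left mult.assoc)
qed

lemma subspace_tangent_space: "subspace (tangent_space s)"
  by (simp add: subspace_def tangent_space_def inner_add_left)

lemma cross3_tangent: "cross3 s x \<in> tangent_space s"
  by (simp add: tangent_space_def dot_cross_self)

lemma matrix_columns_tangent: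
  "\<forall>i. column i A \<in> tangent_space s \<Longrightarrow> A *v x \<in> tangent_space s"
  by (simp add: tangent_space_def matrix_mult_sum scalar_mult_eq_scaleR inner_sum_left)

section \<open>Integrals over the cell\<close>

lemma cell_integral_eq:
  assumes [measurable]: "(\<lambda>p. f (fst p) (snd p)) \<in> borel_measurable (borel \<Otimes>\<^sub>M borel)"
  shows "cell_integral f = enn2ereal (\<integral>\<^sup>+ p. ennreal (f (fst p) (snd p)) \<partial>cell_measure) -
    enn2ereal (\<integral>\<^sup>+ p. ennreal (- f (fst p) (snd p)) \<partial>cell_measure)"
proof -
  have f: "(\<lambda>z. f z \<xi>) \<in> borel_measurable borel" for \<xi>
  proof -
    have "(\<lambda>z. (z, \<xi>)) \<in> borel \<rightarrow>\<^sub>M borel \<Otimes>\<^sub>M borel" by measurable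
    from measurable_compose[OF this assms] show ?thesis by simp
  qed
  then have f': "(\<lambda>z. - f z \<xi>) \<in> borel_measurable borel" for \<xi> by simp
  have "(\<integral>\<^sup>+ p. ennreal (f (fst p) (snd p)) \<partial>cell_measure) =
      (\<integral>\<^sup>+ \<xi>. (\<integral>\<^sup>+ z\<in>unit_cube. ennreal (f z \<xi>) \<partial>lborel) \<partial>lborel)"
    using f by (subst nn_integral_cell) (simp_all add: nn_integral_cube)
  moreover have "(\<integral>\<^sup>+ p. ennreal (- f (fst p) (snd p)) \<partial>cell_measure) =
      (\<integral>\<^sup>+ \<xi>. (\<integral>\<^sup>+ z\<in>unit_cube. ennreal (- f z \<xi>) \<partial>lborel) \<partial>lborel)"
    using f' by (subst nn_integral_cell) (simp_all add: nn_integral_cube)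
  ultimately show ?thesis by (simp add: cell_integral_def)
qed

text \<open>
  The positive and negative parts of \<open>P - R\<close> need not be \<open>P\<close> and \<open>R\<close>, but
  \<open>f\<^sup>+ + R = P + f\<^sup>-\<close> holds pointwise, and \<open>f\<^sup>- \<le> R\<close> has a finite integral. So the difference of
  the two integrals may be rearranged even when \<open>P\<close> has an infinite integral.
\<close>

lemma cell_integral_diff:
  assumes [measurable]: "(\<lambda>p. f (fst p) (snd p)) \<in> borel_measurable (borel \<Otimes>\<^sub>M borel)"
    "P \<in> borel_measurable (borel \<Otimes>\<^sub>M borel)"
    and eq: "AE p in cell_measure. f (fst p) (snd p) = P p - R p"
    and P: "AE p in cell_measure. 0 \<le> P p" and R: "AE p in cell_measure. 0 \<le> R p"
    and R_int: "integrable cell_measure R"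
  shows "cell_integral f = enn2ereal (\<integral>\<^sup>+ p. ennreal (P p) \<partial>cell_measure) - ereal (LINT p|cell_measure. R p)"
proof -
  let ?F = "\<integral>\<^sup>+ p. ennreal (f (fst p) (snd p)) \<partial>cell_measure"
    and ?G = "\<integral>\<^sup>+ p. ennreal (- f (fst p) (snd p)) \<partial>cell_measure"
    and ?P = "\<integral>\<^sup>+ p. ennreal (P p) \<partial>cell_measure" and ?R = "\<integral>\<^sup>+ p. ennreal (R p) \<partial>cell_measure"
  have [measurable]: "R \<in> borel_measurable cell_measure" using R_int by simp
  have Rq: "?R = ennreal (LINT p|cell_measure. R p)"
    by (rule nn_integral_eq_integral[OF R_int R])
  have R0: "0 \<le> (LINT p|cell_measure. R p)"
    by (rule integral_nonneg_AE[OF R])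
  have "?F + ?R = (\<integral>\<^sup>+ p. ennreal (f (fst p) (snd p)) + ennreal (R p) \<partial>cell_measure)"
    by (rule nn_integral_add[symmetric]) measurable
  also have "\<dots> = (\<integral>\<^sup>+ p. ennreal (P p) + ennreal (- f (fst p) (snd p)) \<partial>cell_measure)"
  proof (rule nn_integral_cong_AE)
    show "AE p in cell_measure. ennreal (f (fst p) (snd p)) + ennreal (R p) =
        ennreal (P p) + ennreal (- f (fst p) (snd p))"
      using eq P R
    proof eventually_elim
      case (elim p)
      then show ?case
        by (cases "R p \<le> P p") (simp_all add: ennreal_plus[symmetric] ennreal_neg del: ennreal_plus)
    qed
  qed
  also have "\<dots> = ?P + ?G"
    by (rule nn_integral_add) measurable
  finally have bal: "?F + ?R = ?P + ?G" .
  have "?G \<le> ?R"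
    using eq P by (intro nn_integral_mono_AE) (auto elim!: eventually_elim2 intro!: ennreal_leI)
  then have "?G < \<infinity>" using Rq by (auto intro: le_less_trans)
  then obtain y where y: "?G = ennreal y" "0 \<le> y" by (cases ?G) auto
  let ?r = "LINT p|cell_measure. R p"
  have "enn2ereal ?F - enn2ereal ?G = enn2ereal ?P - ereal ?r"
  proof (cases ?F)
    case (real x)
    then have "?F + ?R = ennreal (x + ?r)" using Rq R0 by simp
    then have "?P + ?G = ennreal (x + ?r)" using bal by simp
    then obtain w where w: "?P = ennreal w" "0 \<le> w"
      using y by (cases ?P) auto
    have "ennreal (x + ?r) = ennreal (w + y)"
      using \<open>?P + ?G = ennreal (x + ?r)\<close> w y by simp
    then have "x + ?r = w + y"
      using real w y R0 by (subst (asm) ennreal_inj) auto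
    then show ?thesis
      using real w y by (simp add: enn2ereal_ennreal)
  next
    case top
    then have "?P + ?G = top" using bal by simp
    then have "?P = top" using y by (cases ?P) (auto simp flip: ennreal_plus)
    then show ?thesis
      using top y by (simp add: enn2ereal_ennreal)
  qed
  then show ?thesis by (simp add: cell_integral_eq)
qed

lemma integrable_cell_snd:
  fixes f :: "real^3 \<Rightarrow> 'b::{banach, second_countable_topology}"
  assumes "integrable lborel f"
  shows "integrable cell_measure (\<lambda>p. f (snd p))"
proof -
  have [measurable]: "f \<in> borel_measurable borel" using assms by auto
  have "(\<integral>\<^sup>+ p. ennreal (norm (f (snd p))) \<partial>cell_measure) = (\<integral>\<^sup>+ \<xi>. ennreal (norm (f \<xi>)) \<partial>lborel)"
    using cube.emeasure_space_1 by (subst nn_integral_cell) simp_all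
  then show ?thesis
    using assms by (subst integrable_iff_bounded) (auto simp: integrable_iff_bounded)
qed

lemma iterated_integral_cell:
  fixes F :: "real^3 \<Rightarrow> real^3 \<Rightarrow> 'b::{banach, second_countable_topology}"
  assumes [measurable]: "(\<lambda>p. F (fst p) (snd p)) \<in> borel_measurable (borel \<Otimes>\<^sub>M borel)"
    and int: "integrable cell_measure (\<lambda>p. F (fst p) (snd p))"
  shows "(LINT \<xi>|lborel. (LINT z:unit_cube|lborel. F z \<xi>)) = (LINT p|cell_measure. F (fst p) (snd p))"
proof -
  have f: "(\<lambda>z. F z \<xi>) \<in> borel_measurable borel" for \<xi>
  proof -
    have "(\<lambda>z. (z, \<xi>)) \<in> borel \<rightarrow>\<^sub>M borel \<Otimes>\<^sub>M borel" by measurable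
    from measurable_compose[OF this assms(1)] show ?thesis by simp
  qed
  have "integrable (cube_measure \<Otimes>\<^sub>M lborel) (case_prod F)"
    using int by (simp add: cell_measure_def split_beta')
  from cell.integral_snd[OF this] show ?thesis
    by (simp add: integral_cube[OF f, symmetric] cell_measure_def split_beta')
qed

section \<open>Exchange and antisymmetric exchange energies\<close>

text \<open>
  The constants \<open>c\<close> and \<open>r\<close> witness the positive essential infimum of \<open>\<rho> \<xi> / |\<xi>|\<^sup>2\<close> near the
  origin.
\<close>

locale exchange_dmi_cell =
  fixes a \<kappa> :: "(real^3) \<times> (real^3) \<Rightarrow> real" and \<rho> :: "real^3 \<Rightarrow> real" and \<nu> :: "real^3 \<Rightarrow> real^3"
    and a\<^sub>0 c r :: real
  assumes a_Linfty: "in_Linfty a" and kappa_Linfty: "in_Linfty \<kappa>"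
    and a0_pos: "0 < a\<^sub>0" and a_lower: "AE p in lborel. a\<^sub>0 \<le> a p"
    and rho_integrable: "integrable lborel \<rho>" and rho_nonneg: "AE \<xi> in lborel. 0 \<le> \<rho> \<xi>"
    and c_pos: "0 < c" and r_pos: "0 < r"
    and rho_lower: "AE \<xi> in lborel. norm \<xi> < r \<longrightarrow> c * (norm \<xi>)\<^sup>2 \<le> \<rho> \<xi>"
    and nu_integrable: "integrable lborel \<nu>"
    and nu_support: "AE \<xi> in lborel. \<rho> \<xi> = 0 \<longrightarrow> \<nu> \<xi> = 0"
    and nu_rho: "integrable lborel (\<lambda>\<xi>. (norm (\<nu> \<xi> /\<^sub>R sqrt (\<rho> \<xi>)))\<^sup>2)"
begin

definition weight :: "(real^3) \<times> (real^3) \<Rightarrow> real" where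
  "weight p = a (fst p, fst p + snd p) * \<rho> (snd p)"

definition kernel :: "(real^3) \<times> (real^3) \<Rightarrow> real" where
  "kernel p = \<kappa> (fst p, fst p + snd p)"

lemma rho_measurable[measurable]: "\<rho> \<in> borel_measurable borel"
  using rho_integrable by auto

lemma nu_measurable[measurable]: "\<nu> \<in> borel_measurable borel"
  using nu_integrable by auto

lemma a_measurable[measurable]: "a \<in> borel_measurable (borel \<Otimes>\<^sub>M borel)"
  using a_Linfty by (simp add: in_Linfty_def borel_prod)

lemma kappa_measurable[measurable]: "\<kappa> \<in> borel_measurable (borel \<Otimes>\<^sub>M borel)"
  using kappa_Linfty by (simp add: in_Linfty_def borel_prod)

lemma weight_measurable[measurable]: "weight \<in> borel_measurable (borel \<Otimes>\<^sub>M borel)"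
  unfolding weight_def by measurable

lemma kernel_measurable[measurable]: "kernel \<in> borel_measurable (borel \<Otimes>\<^sub>M borel)"
  unfolding kernel_def by measurable

lemma AE_cell_snd: "AE \<xi> in lborel. P \<xi> \<Longrightarrow> AE p in cell_measure. P (snd p)"
  unfolding cell_measure_def by (rule cell.AE_pair_snd)

lemma weight_ge: "AE p in cell_measure. a\<^sub>0 * \<rho> (snd p) \<le> weight p"
  using AE_cell_measure[OF AE_lborel_shear[OF a_lower]] AE_cell_snd[OF rho_nonneg]
  by eventually_elim (simp add: weight_def mult_right_mono)

lemma weight_le: obtains C where "AE p in cell_measure. weight p \<le> C * \<rho> (snd p)"
proof -
  obtain C where "AE p in lborel. \<bar>a p\<bar> \<le> C"
    using a_Linfty by (auto simp: in_Linfty_def)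
  from AE_cell_measure[OF AE_lborel_shear[OF this]] AE_cell_snd[OF rho_nonneg]
  have "AE p in cell_measure. weight p \<le> C * \<rho> (snd p)"
    by eventually_elim (auto simp: weight_def intro!: mult_right_mono)
  then show thesis by (rule that)
qed

lemma kernel_bounded: obtains C where "AE p in cell_measure. \<bar>kernel p\<bar> \<le> C"
proof -
  obtain C where "AE p in lborel. \<bar>\<kappa> p\<bar> \<le> C"
    using kappa_Linfty by (auto simp: in_Linfty_def)
  from AE_cell_measure[OF AE_lborel_shear[OF this]]
  have "AE p in cell_measure. \<bar>kernel p\<bar> \<le> C"
    by (simp add: kernel_def)
  then show thesis by (rule that)
qed

lemma weight_nonneg: "AE p in cell_measure. 0 \<le> weight p"
  using weight_ge AE_cell_snd[OF rho_nonneg]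
proof eventually_elim
  case (elim p)
  then have "0 \<le> a\<^sub>0 * \<rho> (snd p)" using a0_pos by simp
  then show ?case using elim by linarith
qed

lemma weight_zero_nu: "AE p in cell_measure. weight p = 0 \<longrightarrow> \<nu> (snd p) = 0"
  using weight_ge AE_cell_snd[OF rho_nonneg] AE_cell_snd[OF nu_support]
proof eventually_elim
  case (elim p)
  show ?case
  proof
    assume "weight p = 0"
    then have "\<rho> (snd p) = 0"
      using elim a0_pos by (smt (verit) mult_pos_pos)
    then show "\<nu> (snd p) = 0" using elim by simp
  qed
qed

lemma weight_lower: "AE p in cell_measure. norm (snd p) < r \<longrightarrow> (a\<^sub>0 * c) * (norm (snd p))\<^sup>2 \<le> weight p"
  using weight_ge AE_cell_snd[OF rho_lower]
proof eventually_elim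
  case (elim p)
  show ?case
  proof
    assume "norm (snd p) < r"
    then have "a\<^sub>0 * (c * (norm (snd p))\<^sup>2) \<le> a\<^sub>0 * \<rho> (snd p)"
      using elim a0_pos by (intro mult_left_mono) auto
    then show "(a\<^sub>0 * c) * (norm (snd p))\<^sup>2 \<le> weight p"
      using elim by (simp add: mult.assoc)
  qed
qed

sublocale nonlocal_weight weight "a\<^sub>0 * c" r
  using weight_nonneg weight_lower a0_pos c_pos r_pos by unfold_locales auto

lemma integrable_weighted:
  assumes "f \<in> borel_measurable (borel \<Otimes>\<^sub>M borel)"
  shows "integrable weighted (f :: _ \<Rightarrow> real) \<longleftrightarrow> integrable cell_measure (\<lambda>p. weight p * f p)"
  using assms unfolding weighted_def
  by (subst integrable_density) (measurable, simp_all add: weight_nonneg)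

lemma integral_weighted:
  assumes "f \<in> borel_measurable (borel \<Otimes>\<^sub>M borel)"
  shows "(LINT p|weighted. (f p :: real)) = (LINT p|cell_measure. weight p * f p)"
  using assms unfolding weighted_def
  by (subst integral_density) (measurable, simp_all add: weight_nonneg)

lemma sq_integrable_weightedI:
  assumes [measurable]: "f \<in> borel_measurable (borel \<Otimes>\<^sub>M borel)"
    and "integrable cell_measure (\<lambda>p. weight p * (norm (f p))\<^sup>2)"
  shows "sq_integrable weighted f"
proof -
  have "f \<in> borel_measurable weighted" by measurable
  moreover have "(\<lambda>p. (norm (f p))\<^sup>2) \<in> borel_measurable (borel \<Otimes>\<^sub>M borel)" by measurable
  ultimately show ?thesis
    using assms(2) by (simp add: sq_integrable_def integrable_weighted)
qed

definition direction :: "(real^3) \<times> (real^3) \<Rightarrow> real^3" where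
  "direction p = snd p /\<^sub>R norm (snd p)"

text \<open>
  The field that completes the square: adding it to \<open>x\<close> changes \<open>weight * |x|\<^sup>2\<close> by the
  antisymmetric exchange term \<open>kernel * (x \<bullet> \<nu>)\<close> and by a term independent of \<open>x\<close>.
\<close>

definition dmi_field :: "(real^3) \<times> (real^3) \<Rightarrow> real^3" where
  "dmi_field p = (kernel p / (2 * weight p)) *\<^sub>R \<nu> (snd p)"

lemma direction_measurable[measurable]: "direction \<in> borel_measurable (borel \<Otimes>\<^sub>M borel)"
  unfolding direction_def by measurable

lemma dmi_field_measurable[measurable]: "dmi_field \<in> borel_measurable (borel \<Otimes>\<^sub>M borel)"
  unfolding dmi_field_def by measurable

lemma norm_direction: "norm (direction p) \<le> 1"
  by (cases "snd p = 0") (simp_all add: direction_def)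

lemma integrable_weight: "integrable cell_measure weight"
proof -
  obtain C where C: "AE p in cell_measure. weight p \<le> C * \<rho> (snd p)" by (rule weight_le)
  have int: "integrable cell_measure (\<lambda>p. C * \<rho> (snd p))"
    by (intro integrable_mult_right integrable_cell_snd rho_integrable)
  show ?thesis
  proof (rule Bochner_Integration.integrable_bound[OF int])
    show "AE p in cell_measure. norm (weight p) \<le> norm (C * \<rho> (snd p))"
      using C weight_nonneg by eventually_elim simp
  qed measurable
qed

lemma direction_sq_integrable: "sq_integrable weighted direction"
proof -
  have "integrable cell_measure (\<lambda>p. weight p * (norm (direction p))\<^sup>2)"
  proof (rule Bochner_Integration.integrable_bound[OF integrable_weight])
    show "AE p in cell_measure. norm (weight p * (norm (direction p))\<^sup>2) \<le> norm (weight p)"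
      by (auto simp: abs_mult intro!: AE_I2 mult_right_le_one_le power_le_one norm_direction)
  qed measurable
  then show ?thesis
    by (intro sq_integrable_weightedI) measurable
qed

text \<open>
  Here \<open>weight * |dmi_field|\<^sup>2 = kernel\<^sup>2 |\<nu>|\<^sup>2 / (4 weight)\<close>, and \<open>weight\<close> is at least
  \<open>a\<^sub>0 \<rho>\<close>, so the square integrability of \<open>\<nu> / sqrt \<rho>\<close> is exactly what is needed.
\<close>

lemma dmi_field_sq_integrable: "sq_integrable weighted dmi_field"
proof -
  obtain C where C: "AE p in cell_measure. \<bar>kernel p\<bar> \<le> C" by (rule kernel_bounded)
  have int: "integrable cell_measure (\<lambda>p. C\<^sup>2 / (4 * a\<^sub>0) * (norm (\<nu> (snd p) /\<^sub>R sqrt (\<rho> (snd p))))\<^sup>2)"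
    by (intro integrable_mult_right integrable_cell_snd nu_rho)
  have "integrable cell_measure (\<lambda>p. weight p * (norm (dmi_field p))\<^sup>2)"
  proof (rule Bochner_Integration.integrable_bound[OF int])
    show "AE p in cell_measure. norm (weight p * (norm (dmi_field p))\<^sup>2) \<le>
        norm (C\<^sup>2 / (4 * a\<^sub>0) * (norm (\<nu> (snd p) /\<^sub>R sqrt (\<rho> (snd p))))\<^sup>2)"
      using C weight_ge AE_cell_snd[OF rho_nonneg] AE_cell_snd[OF nu_support]
    proof eventually_elim
      case (elim p)
      let ?n = "norm (\<nu> (snd p))" and ?\<rho> = "\<rho> (snd p)"
      have "weight p * (norm (dmi_field p))\<^sup>2 \<le> C\<^sup>2 / (4 * a\<^sub>0) * (norm (\<nu> (snd p) /\<^sub>R sqrt ?\<rho>))\<^sup>2"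
      proof (cases "?\<rho> = 0")
        case True
        then show ?thesis using elim by (simp add: dmi_field_def)
      next
        case False
        then have \<rho>: "0 < ?\<rho>" using elim by simp
        then have w: "0 < weight p" using elim a0_pos by (smt (verit) mult_pos_pos)
        have "weight p * (norm (dmi_field p))\<^sup>2 = (kernel p)\<^sup>2 * ?n\<^sup>2 / (4 * weight p)"
          using w by (simp add: dmi_field_def power_mult_distrib power_divide power2_eq_square)
        also have "\<dots> \<le> C\<^sup>2 * ?n\<^sup>2 / (4 * (a\<^sub>0 * ?\<rho>))"
          using elim \<rho> a0_pos w by (intro frac_le mult_right_mono) (auto simp: abs_le_square_iff[symmetric])
        also have "\<dots> = C\<^sup>2 / (4 * a\<^sub>0) * (norm (\<nu> (snd p) /\<^sub>R sqrt ?\<rho>))\<^sup>2"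
          using \<rho> a0_pos by (simp add: power_mult_distrib power_inverse field_simps)
        finally show ?thesis .
      qed
      moreover have "0 \<le> weight p"
        using elim a0_pos by (smt (verit) mult_nonneg_nonneg)
      ultimately show ?case
        using a0_pos by simp
    qed
  qed measurable
  then show ?thesis
    by (intro sq_integrable_weightedI) measurable
qed

text \<open>
  A common form of the functionals in play: \<open>B\<close> is the affine part of the deformation and \<open>S\<close> acts
  on the field \<open>\<nu>\<close>. The exchange problem has \<open>B = id\<close>, \<open>S = 0\<close>; the problem for \<open>\<nu>\<close> has \<open>B = 0\<close>,
  \<open>S = id\<close>; the homogenized energy has \<open>B = A\<close>, \<open>S = cross3 s\<close>; the Dirichlet energy has
  \<open>B = S = 0\<close>.
\<close>

definition functional :: "(real^3 \<Rightarrow> real^3) \<Rightarrow> (real^3 \<Rightarrow> real^3) \<Rightarrow> (real^3 \<Rightarrow> real^3) \<Rightarrow> ereal" where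
  "functional B S v = cell_integral (\<lambda>z \<xi>.
     a (z, z + \<xi>) * \<rho> \<xi> * ((norm (B \<xi> + v (z + \<xi>) - v z))\<^sup>2 / (norm \<xi>)\<^sup>2) +
     \<kappa> (z, z + \<xi>) * (((B \<xi> + v (z + \<xi>) - v z) /\<^sub>R norm \<xi>) \<bullet> S (\<nu> \<xi>)))"

definition source :: "(real^3 \<Rightarrow> real^3) \<Rightarrow> (real^3 \<Rightarrow> real^3) \<Rightarrow> (real^3) \<times> (real^3) \<Rightarrow> real^3" where
  "source B S p = B (direction p) + S (dmi_field p)"

lemma linear_measurable: "linear (L :: real^3 \<Rightarrow> real^3) \<Longrightarrow> L \<in> borel_measurable borel"
  by (intro borel_measurable_continuous_onI linear_continuous_on) (simp add: linear_conv_bounded_linear)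

lemma linear_sq_integrable:
  "linear (L :: real^3 \<Rightarrow> real^3) \<Longrightarrow> sq_integrable M f \<Longrightarrow> sq_integrable M (\<lambda>x. L (f x))"
  by (rule sq_integrable_bounded_linear) (simp_all add: linear_conv_bounded_linear)

lemma source_sq_integrable: "linear B \<Longrightarrow> linear S \<Longrightarrow> sq_integrable weighted (source B S)"
  unfolding source_def[abs_def]
  by (rule sq_integrable_add[OF linear_sq_integrable[OF _ direction_sq_integrable]
        linear_sq_integrable[OF _ dmi_field_sq_integrable]])

text \<open>
  At almost every point where the weight vanishes, so does \<open>\<nu>\<close>; both sides are then 0, because
  division by 0 makes \<open>dmi_field\<close> vanish there.
\<close>

lemma twice_weight_inner_dmi_field:
  assumes S: "linear S"
  shows "AE p in cell_measure. \<forall>x. 2 * weight p * (x \<bullet> S (dmi_field p)) = kernel p * (x \<bullet> S (\<nu> (snd p)))"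
  using weight_zero_nu
proof eventually_elim
  case (elim p)
  then show ?case
    by (cases "weight p = 0") (simp_all add: dmi_field_def linear_scale[OF S] linear_0[OF S])
qed

text \<open>
  Completing the square pointwise turns the linear term into a shift of the difference quotient, at
  the cost of a constant that does not depend on \<open>v\<close>.
\<close>

lemma functional_eq_energy:
  assumes B: "linear B" and S: "linear S" and v: "v \<in> L2_per0 V"
  shows "functional B S v = enn2ereal (energy (source B S) v) -
    ereal (LINT p|weighted. (norm (S (dmi_field p)))\<^sup>2)"
proof -
  have [measurable]: "v \<in> borel_measurable borel" "B \<in> borel_measurable borel" "S \<in> borel_measurable borel"
    using v linear_measurable B S by (auto simp: L2_per0_iff)
  let ?P = "\<lambda>p. weight p * (norm (source B S p + diff_quot v p))\<^sup>2"
  let ?R = "\<lambda>p. weight p * (norm (S (dmi_field p)))\<^sup>2"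
  have [measurable]: "source B S \<in> borel_measurable (borel \<Otimes>\<^sub>M borel)"
    unfolding source_def by measurable
  have "functional B S v = enn2ereal (\<integral>\<^sup>+ p. ennreal (?P p) \<partial>cell_measure) - ereal (LINT p|cell_measure. ?R p)"
    unfolding functional_def
  proof (rule cell_integral_diff)
    show "AE p in cell_measure.
       a (fst p, fst p + snd p) * \<rho> (snd p) *
       ((norm (B (snd p) + v (fst p + snd p) - v (fst p)))\<^sup>2 / (norm (snd p))\<^sup>2) +
       \<kappa> (fst p, fst p + snd p) *
       (((B (snd p) + v (fst p + snd p) - v (fst p)) /\<^sub>R norm (snd p)) \<bullet> S (\<nu> (snd p))) = ?P p - ?R p"
      using twice_weight_inner_dmi_field[OF S]
    proof eventually_elim
      case (elim p)
      let ?x = "(B (snd p) + v (fst p + snd p) - v (fst p)) /\<^sub>R norm (snd p)"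
      have x: "?x = B (direction p) + diff_quot v p"
        by (simp add: direction_def diff_quot_def linear_scale[OF B] algebra_simps)
      have nx: "(norm (B (snd p) + v (fst p + snd p) - v (fst p)))\<^sup>2 / (norm (snd p))\<^sup>2 = (norm ?x)\<^sup>2"
        by (simp add: power_mult_distrib power_inverse divide_inverse mult.commute)
      have s: "source B S p + diff_quot v p = ?x + S (dmi_field p)"
        unfolding x source_def by simp
      have "weight p * (norm (?x + S (dmi_field p)))\<^sup>2 - weight p * (norm (S (dmi_field p)))\<^sup>2 =
          weight p * (norm ?x)\<^sup>2 + 2 * weight p * (?x \<bullet> S (dmi_field p))"
        unfolding power2_norm_eq_inner inner_add_left inner_add_right
        by (simp add: inner_commute algebra_simps del: inner_scaleR_left inner_scaleR_right)
      then show ?case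
        unfolding nx s elim[rule_format] by (simp add: weight_def kernel_def)
    qed
    show "integrable cell_measure ?R"
      using linear_sq_integrable[OF S dmi_field_sq_integrable]
      unfolding sq_integrable_def by (subst (asm) integrable_weighted) auto
    show "AE p in cell_measure. 0 \<le> ?P p" "AE p in cell_measure. 0 \<le> ?R p"
      using weight_nonneg by (eventually_elim, simp)+
  qed measurable
  moreover have "(\<integral>\<^sup>+ p. ennreal (?P p) \<partial>cell_measure) = energy (source B S) v"
    unfolding energy_def
  proof (subst nn_integral_weighted)
    show "(\<integral>\<^sup>+ p. ennreal (?P p) \<partial>cell_measure) =
        (\<integral>\<^sup>+ p. ennreal (weight p) * ennreal ((norm (source B S p + diff_quot v p))\<^sup>2) \<partial>cell_measure)"
      by (intro nn_integral_cong_AE eventually_mono[OF weight_nonneg]) (simp add: ennreal_mult)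
  qed measurable
  moreover have "(LINT p|cell_measure. ?R p) = (LINT p|weighted. (norm (S (dmi_field p)))\<^sup>2)"
    by (rule integral_weighted[symmetric]) measurable
  ultimately show ?thesis by simp
qed

text \<open>
  The functional is the energy composed with an increasing map of the extended reals.
\<close>

lemma functional_minimizer_iff_critical:
  assumes B: "linear B" and S: "linear S" and V: "subspace V"
  shows "is_arg_min (functional B S) (\<lambda>u. u \<in> L2_per0 V) v \<longleftrightarrow> critical V (source B S) v"
proof -
  have le: "functional B S v \<le> functional B S w \<longleftrightarrow> energy (source B S) v \<le> energy (source B S) w"
    if "v \<in> L2_per0 V" "w \<in> L2_per0 V" for v w
    unfolding functional_eq_energy[OF B S that(1)] functional_eq_energy[OF B S that(2)] less_eq_ennreal.rep_eq
    by (cases "enn2ereal (energy (source B S) v)"; cases "enn2ereal (energy (source B S) w)") auto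
  have "is_arg_min (functional B S) (\<lambda>u. u \<in> L2_per0 V) v \<longleftrightarrow>
      is_arg_min (energy (source B S)) (\<lambda>u. u \<in> L2_per0 V) v"
    using le by (auto simp: is_arg_min_linorder)
  then show ?thesis
    using minimizer_critical[OF V source_sq_integrable[OF B S]]
      critical_minimizer[OF V source_sq_integrable[OF B S]] by blast
qed

lemma functional_unique_minimizer_iff_critical:
  assumes "linear B" "linear S" "subspace V"
  shows "ae_unique_minimizer (functional B S) (L2_per0 V) v \<longleftrightarrow> critical V (source B S) v"
  using critical_unique[OF assms(3) source_sq_integrable[OF assms(1,2)]]
  unfolding ae_unique_minimizer_def functional_minimizer_iff_critical[OF assms] by blast

lemma functional_unique_minimizer_exists:
  assumes "linear B" "linear S"
  shows "\<exists>v. ae_unique_minimizer (functional B S) (L2_per0 UNIV) v"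
  using minimizer_exists[OF source_sq_integrable[OF assms]]
    minimizer_critical[OF subspace_UNIV source_sq_integrable[OF assms]]
  unfolding functional_unique_minimizer_iff_critical[OF assms subspace_UNIV] by blast

text \<open>
  The source depends linearly on the pair \<open>(B, S)\<close>, and so does the solution of the Euler-Lagrange
  equation.
\<close>

lemma critical_superposition:
  assumes v: "critical UNIV (source (\<lambda>x. x) (\<lambda>x. 0)) v" and w: "critical UNIV (source (\<lambda>x. 0) (\<lambda>x. x)) w"
    and B: "linear B" "range B \<subseteq> V" and S: "linear S" "range S \<subseteq> V" and V: "subspace V"
  shows "critical V (source B S) (\<lambda>z. B (v z) + S (w z))"
proof -
  have "critical V (\<lambda>p. B (direction p) + S (dmi_field p)) (\<lambda>z. B (v z) + S (w z))"
    using critical_linear[OF v B] critical_linear[OF w S]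
    by (intro critical_add[OF V linear_sq_integrable[OF B(1) direction_sq_integrable] _
          linear_sq_integrable[OF S(1) dmi_field_sq_integrable]]) (simp_all add: source_def)
  then show ?thesis by (simp add: source_def[abs_def])
qed

text \<open>
  By \<open>critical_energy\<close> the minimal energy is the squared norm of the source minus the Dirichlet
  energy of the solution. Subtracting the constant from the completed square undoes the completion,
  and what remains of the source is the integrand of the functional at \<open>v = 0\<close>.
\<close>

lemma critical_functional_value:
  assumes B: "linear B" and S: "linear S" and crit: "critical V (source B S) v"
  shows "functional B S v = ereal (LINT p|cell_measure. weight p * (norm (B (direction p)))\<^sup>2 +
      kernel p * (B (direction p) \<bullet> S (\<nu> (snd p)))) -
    ereal (LINT p|weighted. (norm (diff_quot v p))\<^sup>2)"
proof -
  let ?b = "\<lambda>p. B (direction p)" and ?s = "\<lambda>p. S (dmi_field p)"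
  have [measurable]: "B \<in> borel_measurable borel" "S \<in> borel_measurable borel"
    using linear_measurable B S by auto
  have v: "v \<in> finite_dirichlet V" "v \<in> L2_per0 V"
    using crit by (auto simp: critical_def finite_dirichlet_def)
  have sq: "sq_integrable weighted ?b" "sq_integrable weighted ?s"
    by (rule linear_sq_integrable[OF B direction_sq_integrable] linear_sq_integrable[OF S dmi_field_sq_integrable])+
  have "(LINT p|weighted. (norm (source B S p))\<^sup>2) - (LINT p|weighted. (norm (?s p))\<^sup>2) =
      (LINT p|weighted. (norm (?b p))\<^sup>2) + 2 * (LINT p|weighted. ?b p \<bullet> ?s p)"
    using integral_sq_norm_add[OF sq, of 1] by (simp add: source_def)
  also have "\<dots> = (LINT p|weighted. (norm (?b p))\<^sup>2 + 2 * (?b p \<bullet> ?s p))"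
    using sq sq_integrable_inner[OF sq] by (simp add: sq_integrable_def)
  also have "\<dots> = (LINT p|cell_measure. weight p * ((norm (?b p))\<^sup>2 + 2 * (?b p \<bullet> ?s p)))"
    by (rule integral_weighted) measurable
  also have "\<dots> = (LINT p|cell_measure. weight p * (norm (?b p))\<^sup>2 + kernel p * (?b p \<bullet> S (\<nu> (snd p))))"
  proof (rule integral_cong_AE)
    show "AE p in cell_measure. weight p * ((norm (?b p))\<^sup>2 + 2 * (?b p \<bullet> ?s p)) =
        weight p * (norm (?b p))\<^sup>2 + kernel p * (?b p \<bullet> S (\<nu> (snd p)))"
      using twice_weight_inner_dmi_field[OF S]
    proof eventually_elim
      case (elim p)
      show ?case using elim[rule_format, of "?b p"] by (simp add: algebra_simps)
    qed
  qed measurable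
  finally have "(LINT p|weighted. (norm (source B S p))\<^sup>2) =
      (LINT p|cell_measure. weight p * (norm (?b p))\<^sup>2 + kernel p * (?b p \<bullet> S (\<nu> (snd p)))) +
      (LINT p|weighted. (norm (?s p))\<^sup>2)" by linarith
  then have eq: "(LINT p|weighted. (norm (source B S p + diff_quot v p))\<^sup>2) =
      (LINT p|cell_measure. weight p * (norm (?b p))\<^sup>2 + kernel p * (?b p \<bullet> S (\<nu> (snd p)))) +
      (LINT p|weighted. (norm (?s p))\<^sup>2) - (LINT p|weighted. (norm (diff_quot v p))\<^sup>2)"
    using critical_energy[OF source_sq_integrable[OF B S] crit] by simp
  have "0 \<le> (LINT p|weighted. (norm (source B S p + diff_quot v p))\<^sup>2)" by simp
  then show ?thesis
    unfolding functional_eq_energy[OF B S v(2)] energy_eq[OF source_sq_integrable[OF B S] v(1)]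
    by (subst enn2ereal_ennreal) (simp_all add: eq)
qed

lemma functional_zero:
  assumes v: "v \<in> finite_dirichlet V"
  shows "functional (\<lambda>x. 0) (\<lambda>x. 0) v = ereal (LINT p|weighted. (norm (diff_quot v p))\<^sup>2)"
proof -
  have l: "linear (\<lambda>x::real^3. 0 :: real^3)" by (simp add: linear_iff)
  have "v \<in> L2_per0 V" using v by (simp add: finite_dirichlet_def)
  from functional_eq_energy[OF l l this] show ?thesis
    using energy_eq[OF source_sq_integrable[OF l l] v] by (simp add: source_def enn2ereal_ennreal)
qed

lemma T_bar_integral:
  fixes A :: "real^3^3"
  shows "(A ** T_bar a \<rho>) \<bullet> A = (LINT p|cell_measure. weight p * (norm (A *v direction p))\<^sup>2)"
  and T_bar_integrable: "integrable cell_measure (\<lambda>p. weight p * (norm (A *v direction p))\<^sup>2)"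
proof -
  let ?M = "\<lambda>p. weight p *\<^sub>R tensor (direction p) (direction p)"
  have int: "integrable cell_measure ?M"
  proof (rule Bochner_Integration.integrable_bound[OF integrable_weight])
    show "AE p in cell_measure. norm (?M p) \<le> norm (weight p)"
      by (auto simp: norm_tensor intro!: AE_I2 mult_right_le_one_le mult_le_one norm_direction)
  qed measurable
  have "T_bar a \<rho> = (LINT p|cell_measure. ?M p)"
    using iterated_integral_cell[of "\<lambda>z \<xi>. ?M (z, \<xi>)"] int
    by (simp add: T_bar_def weight_def direction_def)
  moreover have bl: "bounded_linear (\<lambda>T. (A ** T) \<bullet> A)"
    using linear_matrix_mul_inner[of A A] by (simp add: linear_conv_bounded_linear)
  moreover have eq: "(A ** ?M p) \<bullet> A = weight p * (norm (A *v direction p))\<^sup>2" for p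
    using linear_scale[OF linear_matrix_mul_inner[of A A]]
    by (simp add: matrix_mul_tensor_inner power2_norm_eq_inner)
  ultimately show "(A ** T_bar a \<rho>) \<bullet> A = (LINT p|cell_measure. weight p * (norm (A *v direction p))\<^sup>2)"
    using integral_bounded_linear[OF bl int] by simp
  show "integrable cell_measure (\<lambda>p. weight p * (norm (A *v direction p))\<^sup>2)"
    using integrable_bounded_linear[OF bl int] by (simp add: eq)
qed

lemma d_bar_integral:
  "(\<Sum>i\<in>UNIV. s \<bullet> cross3 (d_bar \<kappa> \<nu> i) (A *v axis i 1)) =
    (LINT p|cell_measure. kernel p * ((A *v direction p) \<bullet> cross3 s (\<nu> (snd p))))"
  and d_bar_integrable:
    "integrable cell_measure (\<lambda>p. kernel p * ((A *v direction p) \<bullet> cross3 s (\<nu> (snd p))))"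
proof -
  let ?D = "\<lambda>i p. (kernel p * direction p $ i) *\<^sub>R \<nu> (snd p)"
  obtain C where C: "AE p in cell_measure. \<bar>kernel p\<bar> \<le> C" by (rule kernel_bounded)
  have [measurable]: "(\<lambda>p. direction p $ i) \<in> borel_measurable (borel \<Otimes>\<^sub>M borel)" for i
    by (rule measurable_compose[OF direction_measurable borel_measurable_nth])
  have int_nu: "integrable cell_measure (\<lambda>p. C *\<^sub>R \<nu> (snd p))"
    by (intro integrable_scaleR_right integrable_cell_snd nu_integrable)
  have int: "integrable cell_measure (?D i)" for i
  proof (rule Bochner_Integration.integrable_bound[OF int_nu])
    show "AE p in cell_measure. norm (?D i p) \<le> norm (C *\<^sub>R \<nu> (snd p))"
      using C
    proof eventually_elim
      case (elim p)
      have "\<bar>direction p $ i\<bar> \<le> 1"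
        using component_le_norm_cart[of "direction p" i] norm_direction[of p] by linarith
      then have "\<bar>kernel p\<bar> * \<bar>direction p $ i\<bar> \<le> \<bar>C\<bar> * 1"
        using elim by (intro mult_mono) auto
      then show ?case by (auto simp: abs_mult intro!: mult_right_mono)
    qed
  qed measurable
  have bl: "bounded_linear (\<lambda>d. s \<bullet> cross3 d w)" for w
    using linear_dot_cross3[of s w] by (simp add: linear_conv_bounded_linear)
  have "d_bar \<kappa> \<nu> i = (LINT p|cell_measure. ?D i p)" for i
    using iterated_integral_cell[of "\<lambda>z \<xi>. ?D i (z, \<xi>)"] int[of i]
    by (simp add: d_bar_def kernel_def direction_def divide_inverse mult.commute)
  then have "(\<Sum>i\<in>UNIV. s \<bullet> cross3 (d_bar \<kappa> \<nu> i) (A *v axis i 1)) =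
      (\<Sum>i\<in>UNIV. (LINT p|cell_measure. s \<bullet> cross3 (?D i p) (A *v axis i 1)))"
    using integral_bounded_linear[OF bl int] by simp
  also have "\<dots> = (LINT p|cell_measure. (\<Sum>i\<in>UNIV. s \<bullet> cross3 (?D i p) (A *v axis i 1)))"
    by (intro Bochner_Integration.integral_sum[symmetric] integrable_bounded_linear[OF bl int])
  finally show "(\<Sum>i\<in>UNIV. s \<bullet> cross3 (d_bar \<kappa> \<nu> i) (A *v axis i 1)) =
    (LINT p|cell_measure. kernel p * ((A *v direction p) \<bullet> cross3 s (\<nu> (snd p))))"
    by (simp add: sum_dot_cross3_columns)
  have "integrable cell_measure (\<lambda>p. \<Sum>i\<in>UNIV. s \<bullet> cross3 (?D i p) (A *v axis i 1))"
    by (intro Bochner_Integration.integrable_sum integrable_bounded_linear[OF bl int])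
  then show "integrable cell_measure (\<lambda>p. kernel p * ((A *v direction p) \<bullet> cross3 s (\<nu> (snd p))))"
    by (simp add: sum_dot_cross3_columns)
qed

end

section \<open>Minimizers of the homogenized energy\<close>

text \<open>
  Any \<open>c\<close> strictly between 0 and the essential infimum will do.
\<close>

lemma essinf_ball_lower_bound:
  assumes "0 < essinf (restrict_space lborel (ball 0 r)) (\<lambda>\<xi>. ereal (\<rho> \<xi> / (norm (\<xi> :: real^3))\<^sup>2))"
  obtains c where "0 < c" "AE \<xi> in lborel. norm \<xi> < r \<longrightarrow> c * (norm \<xi>)\<^sup>2 \<le> \<rho> \<xi>"
proof -
  let ?M = "restrict_space lborel (ball 0 r :: (real^3) set)"
    and ?h = "\<lambda>\<xi>. ereal (\<rho> \<xi> / (norm \<xi>)\<^sup>2)"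
  obtain c where c: "0 < ereal c" "ereal c < essinf ?M ?h"
    using ereal_dense2[OF assms] by blast
  have "AE \<xi> in ?M. - ?h \<xi> \<le> esssup ?M (\<lambda>\<xi>. - ?h \<xi>)"
    by (rule esssup_AE)
  then have "AE \<xi> in ?M. c \<le> \<rho> \<xi> / (norm \<xi>)\<^sup>2"
  proof eventually_elim
    case (elim \<xi>)
    have "ereal c \<le> essinf ?M ?h" using c by simp
    also have "\<dots> \<le> ?h \<xi>"
      unfolding essinf_def using elim by (simp add: ereal_uminus_le_reorder)
    finally show ?case by simp
  qed
  then have "AE \<xi> in lborel. \<xi> \<in> ball 0 r \<longrightarrow> c \<le> \<rho> \<xi> / (norm \<xi>)\<^sup>2"
    by (subst (asm) AE_restrict_space_iff) auto
  then have "AE \<xi> in lborel. norm \<xi> < r \<longrightarrow> c * (norm \<xi>)\<^sup>2 \<le> \<rho> \<xi>"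
  proof eventually_elim
    case (elim \<xi>)
    show ?case
    proof
      assume "norm \<xi> < r"
      then have le: "c \<le> \<rho> \<xi> / (norm \<xi>)\<^sup>2" using elim by simp
      \<comment> \<open>At the origin the quotient is 0, below \<open>c\<close>.\<close>
      then have "\<xi> \<noteq> 0" using c by auto
      then show "c * (norm \<xi>)\<^sup>2 \<le> \<rho> \<xi>"
        using le by (simp add: field_simps)
    qed
  qed
  then show thesis using that[of c] c by simp
qed

theorem proposition5p3:
  fixes a \<kappa> :: "(real^3) \<times> (real^3) \<Rightarrow> real"
    and \<rho> :: "real^3 \<Rightarrow> real"
    and \<nu> :: "real^3 \<Rightarrow> real^3"
    and a\<^sub>0 :: real
    and s :: "real^3"
    and A :: "real^3^3"
  assumes A1: "in_Linfty a" "in_Linfty \<kappa>" "Q_periodic2 a" "Q_periodic2 \<kappa>"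
      "0 < a\<^sub>0" "AE p in lborel. a\<^sub>0 \<le> a p"
    and A2: "integrable lborel \<rho>" "AE \<xi> in lborel. 0 \<le> \<rho> \<xi>" "(LINT \<xi>|lborel. \<bar>\<rho> \<xi>\<bar>) = 1"
      "\<exists>r>0. 0 < essinf (restrict_space lborel (ball 0 r)) (\<lambda>\<xi>. ereal (\<rho> \<xi> / (norm \<xi>)\<^sup>2))"
    and A3: "integrable lborel \<nu>" "(LINT \<xi>|lborel. norm (\<nu> \<xi>)) = 1"
    and A4: "AE \<xi> in lborel. \<rho> \<xi> = 0 \<longrightarrow> \<nu> \<xi> = 0"
      "integrable lborel (\<lambda>\<xi>. (norm (\<nu> \<xi> /\<^sub>R sqrt (\<rho> \<xi>)))\<^sup>2)"
    and s: "s \<in> sphere 0 1"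
    and A: "\<forall>i. column i A \<in> tangent_space s"
  shows "(\<exists>v\<^sub>a. ae_unique_minimizer (exchange_cell_energy a \<rho>) (L2_per0 UNIV) v\<^sub>a) \<and>
    (\<exists>v\<^sub>\<kappa>. ae_unique_minimizer (dmi_cell_energy a \<kappa> \<rho> \<nu>) (L2_per0 UNIV) v\<^sub>\<kappa>) \<and>
    (\<forall>v\<^sub>a v\<^sub>\<kappa>. ae_unique_minimizer (exchange_cell_energy a \<rho>) (L2_per0 UNIV) v\<^sub>a \<longrightarrow>
       ae_unique_minimizer (dmi_cell_energy a \<kappa> \<rho> \<nu>) (L2_per0 UNIV) v\<^sub>\<kappa> \<longrightarrow>
       (let v = (\<lambda>z. A *v v\<^sub>a z + cross3 s (v\<^sub>\<kappa> z)) in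
         ae_unique_minimizer (hom_energy a \<kappa> \<rho> \<nu> s A) (L2_per0 (tangent_space s)) v \<and>
         f_hom a \<kappa> \<rho> \<nu> s A =
           ereal ((A ** T_bar a \<rho>) \<bullet> A + (\<Sum>i\<in>UNIV. s \<bullet> cross3 (d_bar \<kappa> \<nu> i) (A *v axis i 1)))
           - dirichlet_energy a \<rho> v))"
proof -
  obtain r where r: "0 < r"
      "0 < essinf (restrict_space lborel (ball 0 r)) (\<lambda>\<xi>. ereal (\<rho> \<xi> / (norm \<xi>)\<^sup>2))"
    using A2(4) by blast
  obtain c where c: "0 < c" "AE \<xi> in lborel. norm \<xi> < r \<longrightarrow> c * (norm \<xi>)\<^sup>2 \<le> \<rho> \<xi>"
    using r(2) by (rule essinf_ball_lower_bound)
  interpret exchange_dmi_cell a \<kappa> \<rho> \<nu> a\<^sub>0 c r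
    using A1 A2 A3 A4 r c by unfold_locales
  let ?id = "\<lambda>x :: real^3. x" and ?zero = "\<lambda>x :: real^3. 0 :: real^3"
  have lin: "linear ?id" "linear ?zero" "linear ((*v) A)" "linear (cross3 s)"
    by (simp_all add: linear_iff linear_cross3[unfolded linear_iff] matrix_vector_right_distrib
        matrix_vector_mult_scaleR)
  have exch: "exchange_cell_energy a \<rho> = functional ?id ?zero"
    by (simp add: fun_eq_iff exchange_cell_energy_def functional_def)
  have dmi: "dmi_cell_energy a \<kappa> \<rho> \<nu> = functional ?zero ?id"
    by (simp add: fun_eq_iff dmi_cell_energy_def functional_def inner_commute)
  have hom: "hom_energy a \<kappa> \<rho> \<nu> s A = functional ((*v) A) (cross3 s)"
    by (simp add: fun_eq_iff hom_energy_def functional_def)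
  have dir: "dirichlet_energy a \<rho> = functional ?zero ?zero"
    by (simp add: fun_eq_iff dirichlet_energy_def functional_def)
  note T = subspace_tangent_space[of s]
  show ?thesis
    unfolding exch dmi hom Let_def
  proof (intro conjI allI impI)
    show "\<exists>v. ae_unique_minimizer (functional ?id ?zero) (L2_per0 UNIV) v"
      "\<exists>v. ae_unique_minimizer (functional ?zero ?id) (L2_per0 UNIV) v"
      by (intro functional_unique_minimizer_exists lin)+
  next
    fix v\<^sub>a v\<^sub>\<kappa>
    assume "ae_unique_minimizer (functional ?id ?zero) (L2_per0 UNIV) v\<^sub>a"
      and "ae_unique_minimizer (functional ?zero ?id) (L2_per0 UNIV) v\<^sub>\<kappa>"
    then have va: "critical UNIV (source ?id ?zero) v\<^sub>a" and vk: "critical UNIV (source ?zero ?id) v\<^sub>\<kappa>"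
      by (simp_all add: functional_unique_minimizer_iff_critical lin)
    let ?v = "\<lambda>z. A *v v\<^sub>a z + cross3 s (v\<^sub>\<kappa> z)"
    have v: "critical (tangent_space s) (source ((*v) A) (cross3 s)) ?v"
      using matrix_columns_tangent[OF A] cross3_tangent
      by (intro critical_superposition[OF va vk] lin T) auto
    then show min: "ae_unique_minimizer (functional ((*v) A) (cross3 s)) (L2_per0 (tangent_space s)) ?v"
      by (simp add: functional_unique_minimizer_iff_critical lin T)
    have "f_hom a \<kappa> \<rho> \<nu> s A = functional ((*v) A) (cross3 s) ?v"
      unfolding f_hom_def hom
    proof (rule antisym)
      show "(INF v\<in>L2_per0 (tangent_space s). functional ((*v) A) (cross3 s) v) \<le> functional ((*v) A) (cross3 s) ?v"
        using min by (intro INF_lower) (simp add: ae_unique_minimizer_def is_arg_min_def)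
      show "functional ((*v) A) (cross3 s) ?v \<le> (INF v\<in>L2_per0 (tangent_space s). functional ((*v) A) (cross3 s) v)"
        using min by (intro INF_greatest) (simp add: ae_unique_minimizer_def is_arg_min_linorder)
    qed
    also have "\<dots> = ereal (LINT p|cell_measure. weight p * (norm (A *v direction p))\<^sup>2 +
        kernel p * ((A *v direction p) \<bullet> cross3 s (\<nu> (snd p)))) - dirichlet_energy a \<rho> ?v"
      using v unfolding dir critical_functional_value[OF lin(3,4) v]
      by (subst functional_zero) (auto simp: critical_def)
    also have "(LINT p|cell_measure. weight p * (norm (A *v direction p))\<^sup>2 +
        kernel p * ((A *v direction p) \<bullet> cross3 s (\<nu> (snd p)))) =
        (A ** T_bar a \<rho>) \<bullet> A + (\<Sum>i\<in>UNIV. s \<bullet> cross3 (d_bar \<kappa> \<nu> i) (A *v axis i 1))"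
      unfolding T_bar_integral d_bar_integral
      by (intro Bochner_Integration.integral_add T_bar_integrable d_bar_integrable)
    finally show "f_hom a \<kappa> \<rho> \<nu> s A =
        ereal ((A ** T_bar a \<rho>) \<bullet> A + (\<Sum>i\<in>UNIV. s \<bullet> cross3 (d_bar \<kappa> \<nu> i) (A *v axis i 1)))
        - dirichlet_energy a \<rho> ?v" .
  qed
qed

end
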